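(* Let $\alpha\in(0,1)$ and suppose that Assumption A (stated in the context) holds for every $h\in\mathcal{H}$. Let $\lambda=\{f(g(\theta_0)|\theta_0)\nabla_\theta g(\theta_0)\}^{-1}$, let $Y_{(1)}=\min\{Y_1,\ldots,Y_n\}$, and define the test $$\phi_n^+(Y^n)=\begin{cases}1 & \text{if } Y_{(1)}<\max\left\{g(\theta_0),\,g\left(\theta_0+\frac{\lambda}{n}\log\frac1{1-\alpha}\right)\right\},\\ 0 & \text{if } Y_{(1)}\ge\max\left\{g(\theta_0),\,g\left(\theta_0+\frac{\lambda}{n}\log\frac1{1-\alpha}\right)\right\}.\end{cases}$$ Then $\{\phi_n^+(Y^n)\}$ is asymptotically uniformly most powerful (AUMP) in $\mathcal{H}$ at asymptotic level $\alpha$ for testing $H_0^+:h\ge 0$ against $H_1^+:h<0$. That is, $\limsup_n E_{\theta_0+h/n}[\phi_n^+]\le\alpha$ for every $h\ge 0$ in $\mathcal{H}$, and for every other sequence of tests $\{\psi_n\}$ satisfying $\limsup_n E_{\theta_0+h/n}[\psi_n]\le\alpha$ for every $h\ge0$ in $\mathcal{H}$, $$\liminf_n E_{\theta_0+h/n}[\phi_n^+]\ \ge\ \limsup_n E_{\theta_0+h/n}[\psi_n]\quad\text{for every } h<0 \text{ in } \mathcal{H}.$$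
   Context: Model. A scalar random variable $Y\in\mathcal{Y}\subset\mathbb{R}$ has Lebesgue density $f(y|\theta)\mathbb{I}\{y\ge g(\theta)\}$, where $\theta\in\Theta\subset\mathbb{R}$ is a scalar parameter and $\mathbb{I}\{\cdot\}$ is the indicator function. Fix $\theta_0\in\Theta$ and reparametrize locally by $h=n(\theta-\theta_0)\in\mathcal{H}\subset\mathbb{R}$. One observes an i.i.d. sample $Y^n=(Y_1,\ldots,Y_n)$ of $Y$. $P_{\theta_0+h/n}$ and $E_{\theta_0+h/n}$ denote probability and expectation when $Y_1,\dots,Y_n$ are i.i.d. from the density with $\theta=\theta_0+h/n$ ($n$ large enough that $\theta_0+h/n\in\Theta$). A test is a measurable function of $Y^n$ with values in $[0,1]$, interpreted as the probability of rejecting the null. Assumption A. (i) $\{Y_i\}_{i=1}^n$ is an i.i.d. sample of $Y$ with the Lebesgue density $f(y|\theta)\mathbb{I}\{y\ge g(\theta)\}$. $\Theta$ is convex, $\theta_0\in\mathrm{int}(\Theta)$, and $0\in\mathcal{H}$. (ii) $f(y|\theta)$ is twice continuously differentiable in $\theta$ for all $y$. In some open neighborhood $\mathcal{N}$ of $\theta_0$: $f(y|\theta)$ and $\nabla_\theta f(y|\theta)$ are continuous in $y$ for $\theta\in\mathcal{N}$; there is a constant $C$ such that $0<f(y|\theta)<C<\infty$ and $|\nabla_\theta f(y|\theta)|<C<\infty$ for all $y$ and $\theta\in\mathcal{N}$; and $$\int\sup_{\theta\in\mathcal{N}}\|\nabla_\theta f(y|\theta)\|\,\mathbb{I}\{y\ge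 g(\theta)\}\,dy<\infty,$$ $$\int\sup_{\theta,\bar\theta\in\mathcal{N}}\frac{\|\nabla_\theta f(y|\bar\theta)\|^2}{f(y|\bar\theta)^2}\mathbb{I}\{y\ge g(\theta)\}f(y|\theta)\,dy<\infty,$$ $$\int\sup_{\theta,\bar\theta\in\mathcal{N}}\frac{\|\nabla_{\theta\theta} f(y|\bar\theta)\|}{f(y|\bar\theta)}\mathbb{I}\{y\ge g(\theta)\}f(y|\theta)\,dy<\infty.$$ $g(\theta)$ is continuously differentiable in $\theta$, $\nabla_\theta g(\theta_0)>0$, and $\sup_{\theta\in\mathcal{N}}\|\nabla_\theta g(\theta)\|<\infty$. *)

theory Defs
  imports "HOL-Probability.Probability"
begin

text \<open>
  \<open>f y \<theta>\<close> stands for the density value \<open>f(y|\<theta>)\<close>; \<open>df\<close> and \<open>ddf\<close> are its first and second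
  derivatives in \<open>\<theta>\<close>, and \<open>dg\<close> is the derivative of \<open>g\<close>. The functions \<open>f, df, ddf\<close> are
  only meaningful on \<open>\<Y> \<times> T\<close> and \<open>g, dg\<close> only on \<open>T\<close>, where \<open>\<Y>\<close> is the sample space and
  \<open>T\<close> the parameter space.
\<close>

definition obs_law ::
    "real set \<Rightarrow> (real \<Rightarrow> real \<Rightarrow> real) \<Rightarrow> (real \<Rightarrow> real) \<Rightarrow> real \<Rightarrow> real measure" where
  "obs_law \<Y> f g \<theta> =
     density lborel (\<lambda>y. ennreal (f y \<theta>) * indicator {y \<in> \<Y>. g \<theta> \<le> y} y)"

definition sample_law ::
    "real set \<Rightarrow> (real \<Rightarrow> real \<Rightarrow> real) \<Rightarrow> (real \<Rightarrow> real) \<Rightarrow> nat \<Rightarrow> real \<Rightarrow> (nat \<Rightarrow> real) measure" where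
  "sample_law \<Y> f g n \<theta> = PiM {1..n} (\<lambda>_. obs_law \<Y> f g \<theta>)"

text \<open>
  The local parameter space \<open>\<H>\<close> enters only through \<open>0 \<in> \<H>\<close>. Derivatives are taken within
  \<open>T\<close>, which is convex with nonempty interior, so they are unique and one-sided at endpoints.
  Since \<open>f\<close> is only defined on \<open>T\<close>, the neighbourhood \<open>N\<close> lies in \<open>T\<close>; the boundary
  points \<open>g \<theta>\<close>, at which \<open>f\<close> is evaluated, lie in \<open>\<Y>\<close>. The moment conditions
  use the extended nonnegative integral, so a supremum may be infinite at some points.
\<close>

locale parameter_dependent_support =
  fixes T :: "real set" and \<theta>\<^sub>0 :: real and \<H> :: "real set" and \<Y> :: "real set"
    and f df ddf :: "real \<Rightarrow> real \<Rightarrow> real" and g dg :: "real \<Rightarrow> real"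
  assumes convex_T: "convex T"
    and \<theta>\<^sub>0_interior: "\<theta>\<^sub>0 \<in> interior T"
    and zero_in_H: "0 \<in> \<H>"
    and Y_borel: "\<Y> \<in> sets borel"
    and density_measurable:
      "\<And>\<theta>. \<theta> \<in> T \<Longrightarrow> (\<lambda>y. f y \<theta> * indicator {y \<in> \<Y>. g \<theta> \<le> y} y) \<in> borel_measurable borel"
    and density_nonneg: "\<And>\<theta> y. \<theta> \<in> T \<Longrightarrow> y \<in> \<Y> \<Longrightarrow> g \<theta> \<le> y \<Longrightarrow> 0 \<le> f y \<theta>"
    and density_prob: "\<And>\<theta>. \<theta> \<in> T \<Longrightarrow> prob_space (obs_law \<Y> f g \<theta>)"
    and f_deriv:
      "\<And>y \<theta>. y \<in> \<Y> \<Longrightarrow> \<theta> \<in> T \<Longrightarrow> (f y has_real_derivative df y \<theta>) (at \<theta> within T)"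
    and df_deriv:
      "\<And>y \<theta>. y \<in> \<Y> \<Longrightarrow> \<theta> \<in> T \<Longrightarrow> (df y has_real_derivative ddf y \<theta>) (at \<theta> within T)"
    and ddf_continuous: "\<And>y. y \<in> \<Y> \<Longrightarrow> continuous_on T (ddf y)"
    and g_deriv: "\<And>\<theta>. \<theta> \<in> T \<Longrightarrow> (g has_real_derivative dg \<theta>) (at \<theta> within T)"
    and dg_continuous: "continuous_on T dg"
    and dg_pos: "0 < dg \<theta>\<^sub>0"
    and neighbourhood:
      "\<exists>N. open N \<and> \<theta>\<^sub>0 \<in> N \<and> N \<subseteq> T \<and> g ` N \<subseteq> \<Y> \<and>
         (\<forall>\<theta>\<in>N. continuous_on \<Y> (\<lambda>y. f y \<theta>) \<and> continuous_on \<Y> (\<lambda>y. df y \<theta>)) \<and>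
         (\<exists>C. \<forall>y\<in>\<Y>. \<forall>\<theta>\<in>N. 0 < f y \<theta> \<and> f y \<theta> < C \<and> \<bar>df y \<theta>\<bar> < C) \<and>
         (\<integral>\<^sup>+y\<in>\<Y>. (SUP \<theta>\<in>N. ennreal (\<bar>df y \<theta>\<bar> * indicator {g \<theta>..} y)) \<partial>lborel) < \<infinity> \<and>
         (\<integral>\<^sup>+y\<in>\<Y>. (SUP (\<theta>, \<theta>')\<in>N \<times> N.
             ennreal (\<bar>df y \<theta>'\<bar>\<^sup>2 / (f y \<theta>')\<^sup>2 * indicator {g \<theta>..} y * f y \<theta>)) \<partial>lborel) < \<infinity> \<and>
         (\<integral>\<^sup>+y\<in>\<Y>. (SUP (\<theta>, \<theta>')\<in>N \<times> N.
             ennreal (\<bar>ddf y \<theta>'\<bar> / f y \<theta>' * indicator {g \<theta>..} y * f y \<theta>)) \<partial>lborel) < \<infinity> \<and>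
         bdd_above ((\<lambda>\<theta>. \<bar>dg \<theta>\<bar>) ` N)"

definition is_test :: "nat \<Rightarrow> ((nat \<Rightarrow> real) \<Rightarrow> real) \<Rightarrow> bool" where
  "is_test n \<phi> \<longleftrightarrow>
     \<phi> \<in> borel_measurable (PiM {1..n} (\<lambda>_. borel)) \<and>
     (\<forall>y \<in> space (PiM {1..n} (\<lambda>_. borel)). 0 \<le> \<phi> y \<and> \<phi> y \<le> 1)"

text \<open>
  In the next two definitions \<open>P n h\<close> is the law of a sample of size \<open>n\<close> under the local parameter
  \<open>h\<close>. It may be arbitrary for the finitely many \<open>n\<close> at which \<open>h\<close> is not an admissible
  local parameter, since only upper and lower limits in \<open>n\<close> are used.
\<close>

definition asymptotic_level ::
    "(nat \<Rightarrow> real \<Rightarrow> (nat \<Rightarrow> real) measure) \<Rightarrow> real set \<Rightarrow> real \<Rightarrow>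
     (nat \<Rightarrow> (nat \<Rightarrow> real) \<Rightarrow> real) \<Rightarrow> bool" where
  "asymptotic_level P H0 \<alpha> \<psi> \<longleftrightarrow>
     (\<forall>h\<in>H0. limsup (\<lambda>n. ereal (\<integral>y. \<psi> n y \<partial>P n h)) \<le> ereal \<alpha>)"

definition AUMP ::
    "(nat \<Rightarrow> real \<Rightarrow> (nat \<Rightarrow> real) measure) \<Rightarrow> real set \<Rightarrow> real set \<Rightarrow> real \<Rightarrow>
     (nat \<Rightarrow> (nat \<Rightarrow> real) \<Rightarrow> real) \<Rightarrow> bool" where
  "AUMP P H0 H1 \<alpha> \<phi> \<longleftrightarrow>
     (\<forall>n. is_test n (\<phi> n)) \<and> asymptotic_level P H0 \<alpha> \<phi> \<and>
     (\<forall>\<psi>. (\<forall>n. is_test n (\<psi> n)) \<longrightarrow> asymptotic_level P H0 \<alpha> \<psi> \<longrightarrow>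
        (\<forall>h\<in>H1. liminf (\<lambda>n. ereal (\<integral>y. \<phi> n y \<partial>P n h)) \<ge> limsup (\<lambda>n. ereal (\<integral>y. \<psi> n y \<partial>P n h))))"

definition boundary_scale ::
    "real \<Rightarrow> (real \<Rightarrow> real \<Rightarrow> real) \<Rightarrow> (real \<Rightarrow> real) \<Rightarrow> (real \<Rightarrow> real) \<Rightarrow> real" where
  "boundary_scale \<theta>\<^sub>0 f g dg = inverse (f (g \<theta>\<^sub>0) \<theta>\<^sub>0 * dg \<theta>\<^sub>0)"

definition phi_plus ::
    "real \<Rightarrow> (real \<Rightarrow> real \<Rightarrow> real) \<Rightarrow> (real \<Rightarrow> real) \<Rightarrow> (real \<Rightarrow> real) \<Rightarrow> real \<Rightarrow>
     nat \<Rightarrow> (nat \<Rightarrow> real) \<Rightarrow> real" where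
  "phi_plus \<theta>\<^sub>0 f g dg \<alpha> n y =
     (if Min (y ` {1..n}) <
         max (g \<theta>\<^sub>0) (g (\<theta>\<^sub>0 + boundary_scale \<theta>\<^sub>0 f g dg / real n * ln (1 / (1 - \<alpha>))))
      then 1 else 0)"

end

theory Submission
  imports Defs
begin

text \<open>
  Near \<open>\<theta>\<^sub>0\<close> all the information about \<open>h\<close> sits in the sample minimum: the experiment behaves like
  one observation from the exponential law of mean \<open>\<kappa> = 1 / (f(g(\<theta>\<^sub>0)|\<theta>\<^sub>0) g'(\<theta>\<^sub>0))\<close> shifted to start
  at \<open>h\<close>. For \<open>h < 0\<close> this shifted law puts mass \<open>1 - e\<close> below \<open>0\<close>, where \<open>e = exp (h / \<kappa>)\<close>, and is
  \<open>e\<close> times the null law above \<open>0\<close>. A test of level \<open>\<alpha>\<close> at \<open>h = 0\<close> can reject always below \<open>0\<close>, but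
  above it rejects with mass at most \<open>\<alpha> e\<close>; its power is therefore at most
  \<open>1 - e + \<alpha> e = 1 - (1 - \<alpha>) e\<close>, and that is the limiting power of the test in the theorem.

  Both halves rest on the count of observations near the boundary. For \<open>s \<le> t\<close> the probability under
  \<open>\<theta>\<^sub>0 + s/n\<close> of an observation below \<open>g(\<theta>\<^sub>0 + t/n)\<close> is asymptotic to \<open>(t - s) / (\<kappa> n)\<close>
  (\<open>boundary_mass_tendsto\<close>), so \<open>(1 - p)\<^sup>n\<close> turns into an exponential and gives the limiting rejection
  probabilities of tests based on the minimum (\<open>min_test_rejection_tendsto\<close>).

  For the upper bound on arbitrary tests the product likelihood ratio on \<open>{y. \<forall>i. g(\<theta>\<^sub>0) \<le> y\<^sub>i}\<close> has to
  converge to the constant \<open>e\<close>. Instead of expanding its logarithm and applying a law of large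
  numbers, the proof compares square roots of likelihoods, because Hellinger affinities of
  products are products of affinities. Above \<open>g(\<theta>\<^sub>0)\<close> the squared Hellinger distance of a single
  observation is \<open>O(1/n\<^sup>2)\<close> by the bound on the Fisher information (\<open>hellinger_rate\<close>), hence negligible
  against the boundary mass of order \<open>1/n\<close>. The affinity of the \<open>n\<close>-fold products then tends to
  \<open>exp (h / (2 \<kappa>)) = sqrt e\<close>, while the mass of the alternative above \<open>g(\<theta>\<^sub>0)\<close> tends to \<open>e\<close>. These are
  the values at which the \<open>L\<^sup>2\<close> distance between the root likelihood of the alternative and \<open>sqrt e\<close>
  times that of the null vanishes, and this forces every acceptance probability under the
  alternative to be at least \<open>e\<close> times the one under the null, up to a vanishing error that is the
  same for all tests (\<open>power_envelope\<close>).
\<close>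

section \<open>Products of densities and Hellinger affinity\<close>

lemma one_minus_power_tendsto_exp:
  fixes p :: "nat \<Rightarrow> real"
  assumes "(\<lambda>n. real n * p n) \<longlonglongrightarrow> r"
  shows "(\<lambda>n. (1 - p n) ^ n) \<longlonglongrightarrow> exp (- r)"
proof -
  have "(\<lambda>n. inverse (real n) * (real n * p n)) \<longlonglongrightarrow> 0 * r"
    by (intro tendsto_mult assms lim_inverse_n)
  then have p0: "p \<longlonglongrightarrow> 0"
    by (rule Lim_transform_eventually[OF tendsto_eq_rhs])
       (auto intro!: eventually_sequentiallyI[of 1])
  then have small: "\<forall>\<^sub>F n in sequentially. \<bar>p n\<bar> \<le> 1 / 2"
    by (auto simp: tendsto_iff elim!: allE[of _ "1/2"] eventually_mono)
  have "(\<lambda>n. 2 * (real n * p n) * p n) \<longlonglongrightarrow> 2 * r * 0"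
    by (intro tendsto_intros assms p0)
  then have "(\<lambda>n. real n * ln (1 - p n) + real n * p n) \<longlonglongrightarrow> 0"
  proof (rule Lim_null_comparison[rotated, OF tendsto_eq_rhs])
    show "\<forall>\<^sub>F n in sequentially.
        norm (real n * ln (1 - p n) + real n * p n) \<le> 2 * (real n * p n) * p n"
      using small
    proof eventually_elim
      case (elim n)
      have "\<bar>ln (1 + - p n) - (- p n)\<bar> \<le> 2 * (- p n)\<^sup>2"
        using elim by (intro abs_ln_one_plus_x_minus_x_bound) auto
      then have "real n * \<bar>ln (1 - p n) + p n\<bar> \<le> real n * (2 * (p n)\<^sup>2)"
        by (intro mult_left_mono) auto
      then show ?case
        by (simp add: power2_eq_square abs_mult flip: distrib_left)
    qed
  qed simp
  from tendsto_diff[OF this assms] have "(\<lambda>n. exp (real n * ln (1 - p n))) \<longlonglongrightarrow> exp (- r)"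
    by (intro tendsto_exp) simp
  then show ?thesis
  proof (rule Lim_transform_eventually)
    show "\<forall>\<^sub>F n in sequentially. exp (real n * ln (1 - p n)) = (1 - p n) ^ n"
      using small by eventually_elim (simp add: exp_of_nat_mult)
  qed
qed

text \<open>
  A Neyman-Pearson argument for samples needs the joint likelihood; the product density is
  checked on boxes, where Tonelli's theorem factorizes the integral.
\<close>

lemma PiM_density:
  fixes M :: "'a measure" and f :: "'a \<Rightarrow> ennreal"
  assumes "sigma_finite_measure M" and "prob_space (density M f)"
    and [measurable]: "f \<in> borel_measurable M" and fin: "finite I"
  shows "PiM I (\<lambda>_. density M f) = density (PiM I (\<lambda>_. M)) (\<lambda>x. \<Prod>i\<in>I. f (x i))"
proof -
  interpret sigma_finite_measure M by fact
  interpret base: product_sigma_finite "\<lambda>_. M" by standard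
  interpret P: prob_space "density M f" by fact
  interpret dens: product_sigma_finite "\<lambda>_. density M f" by standard
  show ?thesis
  proof (rule dens.PiM_eqI[symmetric, OF fin])
    show "sets (density (PiM I (\<lambda>_. M)) (\<lambda>x. \<Prod>i\<in>I. f (x i))) = sets (PiM I (\<lambda>_. density M f))"
      by (simp cong: sets_PiM_cong)
  next
    fix A assume "\<And>i. i \<in> I \<Longrightarrow> A i \<in> sets (density M f)"
    then have A: "\<And>i. i \<in> I \<Longrightarrow> A i \<in> sets M" by simp
    have "emeasure (density (PiM I (\<lambda>_. M)) (\<lambda>x. \<Prod>i\<in>I. f (x i))) (Pi\<^sub>E I A)
        = (\<integral>\<^sup>+x. (\<Prod>i\<in>I. f (x i)) * indicator (Pi\<^sub>E I A) x \<partial>PiM I (\<lambda>_. M))"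
      using A fin by (intro emeasure_density sets_PiM_I_finite) measurable
    also have "\<dots> = (\<integral>\<^sup>+x. (\<Prod>i\<in>I. f (x i) * indicator (A i) (x i)) \<partial>PiM I (\<lambda>_. M))"
    proof (intro nn_integral_cong)
      fix x assume "x \<in> space (PiM I (\<lambda>_. M))"
      then have "indicator (Pi\<^sub>E I A) x = (\<Prod>i\<in>I. indicator (A i) (x i) :: ennreal)"
        using fin by (auto simp: space_PiM PiE_iff indicator_def prod.If_cases extensional_def)
      then show "(\<Prod>i\<in>I. f (x i)) * indicator (Pi\<^sub>E I A) x
          = (\<Prod>i\<in>I. f (x i) * indicator (A i) (x i))"
        by (simp add: prod.distrib)
    qed
    also have "\<dots> = (\<Prod>i\<in>I. \<integral>\<^sup>+y. f y * indicator (A i) y \<partial>M)"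
      using A fin by (intro base.product_nn_integral_prod) auto
    also have "\<dots> = (\<Prod>i\<in>I. emeasure (density M f) (A i))"
      using A by (intro prod.cong refl emeasure_density[symmetric]) auto
    finally show "emeasure (density (PiM I (\<lambda>_. M)) (\<lambda>x. \<Prod>i\<in>I. f (x i))) (Pi\<^sub>E I A)
        = (\<Prod>i\<in>I. emeasure (density M f) (A i))" .
  qed
qed

lemma integrable_sqrt_mult:
  fixes u v :: "'a \<Rightarrow> real"
  assumes "integrable M u" "integrable M v" "\<And>x. x \<in> space M \<Longrightarrow> 0 \<le> u x" "\<And>x. x \<in> space M \<Longrightarrow> 0 \<le> v x"
  shows "integrable M (\<lambda>x. sqrt (u x * v x))"
proof (rule Bochner_Integration.integrable_bound[OF Bochner_Integration.integrable_add[OF assms(1,2)]])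
  show "(\<lambda>x. sqrt (u x * v x)) \<in> borel_measurable M"
    using assms(1,2) by measurable
  show "AE x in M. norm (sqrt (u x * v x)) \<le> norm (u x + v x)"
  proof (rule AE_I2)
    fix x assume x: "x \<in> space M"
    have "sqrt (u x * v x) \<le> (u x + v x) / 2"
      using arith_geo_mean_sqrt[OF assms(3,4)[OF x]] .
    then show "norm (sqrt (u x * v x)) \<le> norm (u x + v x)"
      using assms(3,4)[OF x] by simp
  qed
qed

text \<open>
  A lower bound for the acceptance probability \<open>\<integral> w a\<close> under one density in terms of \<open>c \<integral> w b\<close> under
  another. With \<open>u = sqrt a\<close> and \<open>v = sqrt (c b)\<close> the error \<open>v\<^sup>2 - u\<^sup>2 \<le> 2 v (v - u)\<close> is split by the
  weighted inequality between arithmetic and geometric mean into \<open>k v\<^sup>2\<close> and \<open>(u - v)\<^sup>2 / k\<close>. The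
  integral of \<open>(u - v)\<^sup>2\<close> involves \<open>a\<close> and \<open>b\<close> jointly only through their affinity, and \<open>k\<close> remains
  free so that it can tend to \<open>0\<close> more slowly than this integral.
\<close>

lemma affinity_comparison:
  fixes a b w :: "'a \<Rightarrow> real" and c k :: real
  assumes [measurable]: "integrable M a" "integrable M b" "w \<in> borel_measurable M"
    and a: "\<And>x. x \<in> space M \<Longrightarrow> 0 \<le> a x" and b: "\<And>x. x \<in> space M \<Longrightarrow> 0 \<le> b x"
    and w: "\<And>x. x \<in> space M \<Longrightarrow> 0 \<le> w x \<and> w x \<le> 1"
    and c: "0 \<le> c" and k: "0 < k"
  shows "c * (\<integral>x. w x * b x \<partial>M) \<le> (\<integral>x. w x * a x \<partial>M) + k * c * (\<integral>x. b x \<partial>M)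
    + ((\<integral>x. a x \<partial>M) + c * (\<integral>x. b x \<partial>M) - 2 * sqrt c * (\<integral>x. sqrt (a x * b x) \<partial>M)) / k"
proof -
  have int_wa: "integrable M (\<lambda>x. w x * a x)"
    by (rule Bochner_Integration.integrable_bound[OF assms(1)])
       (auto intro!: AE_I2 simp: a w abs_mult mult_left_le_one_le)
  have int_wb: "integrable M (\<lambda>x. w x * b x)"
    by (rule Bochner_Integration.integrable_bound[OF assms(2)])
       (auto intro!: AE_I2 simp: b w abs_mult mult_left_le_one_le)
  have int_ab: "integrable M (\<lambda>x. sqrt (a x * b x))"
    by (intro integrable_sqrt_mult assms(1,2) a b)
  have "(\<integral>x. c * (w x * b x) \<partial>M) \<le> (\<integral>x. w x * a x + (k * c * b x
      + (a x + c * b x - 2 * sqrt c * sqrt (a x * b x)) / k) \<partial>M)"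
  proof (intro integral_mono)
    fix x assume x: "x \<in> space M"
    define u v where "u = sqrt (a x)" and "v = sqrt (c * b x)"
    have sq: "u\<^sup>2 = a x" "v\<^sup>2 = c * b x" "2 * sqrt c * sqrt (a x * b x) = 2 * u * v"
      using a[OF x] b[OF x] c by (auto simp: u_def v_def real_sqrt_mult power_mult_distrib)
    have "0 \<le> (k * v + (u - v))\<^sup>2 / k"
      using k by simp
    also have "\<dots> = k * v\<^sup>2 + 2 * v * (u - v) + (u - v)\<^sup>2 / k"
      using k by (simp add: field_simps power2_eq_square)
    finally have 1: "v\<^sup>2 - u\<^sup>2 \<le> k * v\<^sup>2 + (u - v)\<^sup>2 / k"
      by (smt (verit) power2_diff zero_le_power2 power2_eq_square right_diff_distrib mult.commute mult.assoc)
    have "0 \<le> k * v\<^sup>2 + (u - v)\<^sup>2 / k"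
      using k by simp
    then have "w x * (v\<^sup>2 - u\<^sup>2) \<le> k * v\<^sup>2 + (u - v)\<^sup>2 / k"
      using w[OF x] mult_left_mono[OF 1, of "w x"] mult_left_le_one_le[of "k * v\<^sup>2 + (u - v)\<^sup>2 / k" "w x"]
      by linarith
    then show "c * (w x * b x) \<le> w x * a x + (k * c * b x
      + (a x + c * b x - 2 * sqrt c * sqrt (a x * b x)) / k)"
      unfolding sq(3) using sq(1,2) by (simp add: power2_diff algebra_simps)
  qed (use int_wa int_wb int_ab assms(1,2) in auto)
  also have "\<dots> = (\<integral>x. w x * a x \<partial>M) + k * c * (\<integral>x. b x \<partial>M)
    + ((\<integral>x. a x \<partial>M) + c * (\<integral>x. b x \<partial>M) - 2 * sqrt c * (\<integral>x. sqrt (a x * b x) \<partial>M)) / k"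
    using int_wa int_ab assms(1,2) by simp
  finally show ?thesis by simp
qed

section \<open>The model near the reference parameter\<close>

context parameter_dependent_support
begin

definition dens :: "real \<Rightarrow> real \<Rightarrow> real" where
  "dens \<theta> y = f y \<theta> * indicator {y \<in> \<Y>. g \<theta> \<le> y} y"

abbreviation f\<^sub>0 :: real where "f\<^sub>0 \<equiv> f (g \<theta>\<^sub>0) \<theta>\<^sub>0"

lemma dens_measurable [measurable]: "\<theta> \<in> T \<Longrightarrow> dens \<theta> \<in> borel_measurable borel"
  unfolding dens_def by (rule density_measurable)

lemma dens_nonneg: "\<theta> \<in> T \<Longrightarrow> 0 \<le> dens \<theta> y"
  by (auto simp: dens_def indicator_def density_nonneg)

lemma obs_law_eq: "obs_law \<Y> f g \<theta> = density lborel (\<lambda>y. ennreal (dens \<theta> y))"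
  unfolding obs_law_def dens_def
  by (intro arg_cong[where f = "density lborel"] ext) (auto simp: indicator_def)

lemma sets_obs_law [measurable_cong]: "sets (obs_law \<Y> f g \<theta>) = sets borel"
  by (simp add: obs_law_eq)

lemma
  assumes "\<theta> \<in> T"
  shows integrable_dens: "integrable lborel (dens \<theta>)"
    and integral_dens: "(\<integral>y. dens \<theta> y \<partial>lborel) = 1"
proof -
  interpret prob_space "obs_law \<Y> f g \<theta>" using density_prob assms .
  have "(\<integral>\<^sup>+y. ennreal (dens \<theta> y) \<partial>lborel) = 1"
    using emeasure_space_1 assms by (simp add: obs_law_eq emeasure_density)
  then have "has_bochner_integral lborel (dens \<theta>) 1"
    using assms by (intro has_bochner_integral_nn_integral) (auto simp: dens_nonneg)
  then show "integrable lborel (dens \<theta>)" "(\<integral>y. dens \<theta> y \<partial>lborel) = 1"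
    by (auto simp: has_bochner_integral_iff)
qed

lemma measure_obs_law:
  assumes "\<theta> \<in> T" and [measurable]: "A \<in> sets borel"
  shows "measure (obs_law \<Y> f g \<theta>) A = (\<integral>y. dens \<theta> y * indicator A y \<partial>lborel)"
proof -
  have "emeasure (obs_law \<Y> f g \<theta>) A = (\<integral>\<^sup>+y. ennreal (dens \<theta> y * indicator A y) \<partial>lborel)"
    using assms unfolding obs_law_eq
    by (subst emeasure_density) (auto intro!: nn_integral_cong simp: indicator_def)
  then show ?thesis
    using assms by (simp add: measure_def integral_eq_nn_integral dens_nonneg)
qed

text \<open>
  The interval around \<open>\<theta>\<^sub>0\<close> on which the local analysis takes place: continuity of \<open>dg\<close> makes \<open>g\<close>
  increasing there, so that the support shrinks as the parameter grows.
\<close>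

lemma regular_ball:
  obtains \<delta> C where "0 < \<delta>" "0 \<le> C"
    "\<And>\<theta>. \<bar>\<theta> - \<theta>\<^sub>0\<bar> < \<delta> \<Longrightarrow> \<theta> \<in> interior T \<and> g \<theta> \<in> \<Y> \<and> 0 < dg \<theta>"
    "\<And>\<theta> y. \<bar>\<theta> - \<theta>\<^sub>0\<bar> < \<delta> \<Longrightarrow> y \<in> \<Y> \<Longrightarrow> 0 < f y \<theta> \<and> \<bar>df y \<theta>\<bar> \<le> C"
    "continuous_on \<Y> (\<lambda>y. f y \<theta>\<^sub>0)"
proof -
  obtain N C where N: "open N" "\<theta>\<^sub>0 \<in> N" "N \<subseteq> T" "g ` N \<subseteq> \<Y>"
    "\<forall>\<theta>\<in>N. continuous_on \<Y> (\<lambda>y. f y \<theta>)"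
    and C: "\<forall>y\<in>\<Y>. \<forall>\<theta>\<in>N. 0 < f y \<theta> \<and> f y \<theta> < C \<and> \<bar>df y \<theta>\<bar> < C"
    using neighbourhood by blast
  have "0 \<le> C"
    using C N(2,4) by (smt (verit) image_subset_iff)
  have NT: "N \<subseteq> interior T"
    using N by (simp add: interior_maximal)
  have "continuous (at \<theta>\<^sub>0) dg"
    using dg_continuous \<theta>\<^sub>0_interior continuous_on_interior by blast
  then have "\<forall>\<^sub>F \<theta> in nhds \<theta>\<^sub>0. 0 < dg \<theta>"
    using dg_pos by (simp add: isCont_def continuous_at tendsto_nhds_iff order_tendstoD)
  moreover have "\<forall>\<^sub>F \<theta> in nhds \<theta>\<^sub>0. \<theta> \<in> N"
    using N by (simp add: eventually_nhds_in_open)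
  ultimately have "\<forall>\<^sub>F \<theta> in nhds \<theta>\<^sub>0. 0 < dg \<theta> \<and> \<theta> \<in> N"
    by eventually_elim simp
  then obtain \<delta> where \<delta>: "0 < \<delta>" "\<And>\<theta>. \<bar>\<theta> - \<theta>\<^sub>0\<bar> < \<delta> \<Longrightarrow> 0 < dg \<theta> \<and> \<theta> \<in> N"
    by (auto simp: eventually_nhds_metric dist_real_def)
  show thesis
  proof (rule that[OF \<delta>(1) \<open>0 \<le> C\<close>])
    show "\<And>\<theta>. \<bar>\<theta> - \<theta>\<^sub>0\<bar> < \<delta> \<Longrightarrow> \<theta> \<in> interior T \<and> g \<theta> \<in> \<Y> \<and> 0 < dg \<theta>"
      using \<delta> NT N(4) by blast
    show "\<And>\<theta> y. \<bar>\<theta> - \<theta>\<^sub>0\<bar> < \<delta> \<Longrightarrow> y \<in> \<Y> \<Longrightarrow> 0 < f y \<theta> \<and> \<bar>df y \<theta>\<bar> \<le> C"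
      using \<delta> C by (meson less_imp_le)
  qed (use N in auto)
qed

lemma f\<^sub>0_pos: "0 < f\<^sub>0"
  using regular_ball by (metis abs_zero diff_self)

text \<open>
  The last property holds by the intermediate value theorem: all points between two boundary
  points are boundary points themselves, hence lie in the sample space. Without it the
  set \<open>\<Y>\<close> could have gaps and the mass near the boundary would be smaller than \<open>f\<^sub>0\<close> predicts.
\<close>

lemma g_strict_mono_near:
  obtains \<delta> where "0 < \<delta>" "\<And>\<theta>. \<bar>\<theta> - \<theta>\<^sub>0\<bar> < \<delta> \<Longrightarrow> \<theta> \<in> T"
    "\<And>a b. \<bar>a - \<theta>\<^sub>0\<bar> < \<delta> \<Longrightarrow> \<bar>b - \<theta>\<^sub>0\<bar> < \<delta> \<Longrightarrow> a < b \<Longrightarrow> g a < g b"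
    "\<And>a b. \<bar>a - \<theta>\<^sub>0\<bar> < \<delta> \<Longrightarrow> \<bar>b - \<theta>\<^sub>0\<bar> < \<delta> \<Longrightarrow> a \<le> b \<Longrightarrow> {g a..g b} \<subseteq> \<Y>"
proof -
  obtain \<delta> C where \<delta>: "0 < \<delta>"
    "\<And>\<theta>. \<bar>\<theta> - \<theta>\<^sub>0\<bar> < \<delta> \<Longrightarrow> \<theta> \<in> interior T \<and> g \<theta> \<in> \<Y> \<and> 0 < dg \<theta>"
    by (rule regular_ball, rule that)
  have deriv: "(g has_real_derivative dg \<theta>) (at \<theta>)" if "\<bar>\<theta> - \<theta>\<^sub>0\<bar> < \<delta>" for \<theta>
    using g_deriv[of \<theta>] \<delta>(2)[OF that] by (metis at_within_interior interior_subset subsetD)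
  show thesis
  proof (rule that[OF \<delta>(1)])
    show "\<theta> \<in> T" if "\<bar>\<theta> - \<theta>\<^sub>0\<bar> < \<delta>" for \<theta>
      using \<delta>(2)[OF that] interior_subset by blast
  next
    fix a b assume ab: "\<bar>a - \<theta>\<^sub>0\<bar> < \<delta>" "\<bar>b - \<theta>\<^sub>0\<bar> < \<delta>" "a < b"
    show "g a < g b"
    proof (rule DERIV_pos_imp_increasing[OF ab(3)])
      fix x assume "a \<le> x" "x \<le> b"
      then have "\<bar>x - \<theta>\<^sub>0\<bar> < \<delta>" using ab by auto
      then show "\<exists>y. (g has_real_derivative y) (at x) \<and> 0 < y" using deriv \<delta>(2) by blast
    qed
  next
    fix a b assume ab: "\<bar>a - \<theta>\<^sub>0\<bar> < \<delta>" "\<bar>b - \<theta>\<^sub>0\<bar> < \<delta>" "a \<le> b"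
    show "{g a..g b} \<subseteq> \<Y>"
    proof
      fix y assume "y \<in> {g a..g b}"
      then have "\<exists>x\<ge>a. x \<le> b \<and> g x = y"
        using ab by (intro IVT) (auto intro!: DERIV_isCont[OF deriv])
      then obtain x where "a \<le> x" "x \<le> b" "g x = y" by blast
      then show "y \<in> \<Y>" using \<delta>(2)[of x] ab by auto
    qed
  qed
qed

text \<open>
  Joint continuity of the density at the boundary point: continuity in \<open>y\<close> is assumed for fixed
  \<open>\<theta>\<close> only, but the bound on \<open>df\<close> makes \<open>f y\<close> Lipschitz in \<open>\<theta>\<close> uniformly in \<open>y\<close>.
\<close>

lemma f_near_f\<^sub>0:
  assumes "0 < \<epsilon>"
  obtains \<eta> where "0 < \<eta>"
    "\<And>\<theta> y. \<bar>\<theta> - \<theta>\<^sub>0\<bar> < \<eta> \<Longrightarrow> y \<in> \<Y> \<Longrightarrow> \<bar>y - g \<theta>\<^sub>0\<bar> < \<eta> \<Longrightarrow> \<bar>f y \<theta> - f\<^sub>0\<bar> \<le> \<epsilon>"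
proof -
  obtain \<delta> C where \<delta>: "0 < \<delta>" "0 \<le> C"
    "\<And>\<theta>. \<bar>\<theta> - \<theta>\<^sub>0\<bar> < \<delta> \<Longrightarrow> \<theta> \<in> interior T \<and> g \<theta> \<in> \<Y> \<and> 0 < dg \<theta>"
    "\<And>\<theta> y. \<bar>\<theta> - \<theta>\<^sub>0\<bar> < \<delta> \<Longrightarrow> y \<in> \<Y> \<Longrightarrow> 0 < f y \<theta> \<and> \<bar>df y \<theta>\<bar> \<le> C"
    "continuous_on \<Y> (\<lambda>y. f y \<theta>\<^sub>0)"
    by (rule regular_ball, rule that)
  have "g \<theta>\<^sub>0 \<in> \<Y>" using \<delta>(1) \<delta>(3)[of \<theta>\<^sub>0] by simp
  then obtain \<rho> where \<rho>: "0 < \<rho>" "\<And>y. y \<in> \<Y> \<Longrightarrow> \<bar>y - g \<theta>\<^sub>0\<bar> < \<rho> \<Longrightarrow> \<bar>f y \<theta>\<^sub>0 - f\<^sub>0\<bar> < \<epsilon> / 2"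
    using \<delta>(5) \<open>0 < \<epsilon>\<close> unfolding continuous_on_iff dist_real_def by (meson half_gt_zero)
  define \<eta> where "\<eta> = min (min \<delta> \<rho>) (\<epsilon> / (2 * (C + 1)))"
  have "0 < \<eta>" using \<delta> \<rho> \<open>0 < \<epsilon>\<close> by (auto simp: \<eta>_def)
  moreover have "\<bar>f y \<theta> - f\<^sub>0\<bar> \<le> \<epsilon>"
    if \<theta>: "\<bar>\<theta> - \<theta>\<^sub>0\<bar> < \<eta>" and y: "y \<in> \<Y>" "\<bar>y - g \<theta>\<^sub>0\<bar> < \<eta>" for \<theta> y
  proof -
    have ball: "x \<in> T \<and> \<bar>x - \<theta>\<^sub>0\<bar> < \<delta>" if "x \<in> cball \<theta>\<^sub>0 \<bar>\<theta> - \<theta>\<^sub>0\<bar>" for x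
      using that \<theta> \<delta>(3) interior_subset[of T] by (auto simp: \<eta>_def dist_real_def)
    have "norm (f y \<theta> - f y \<theta>\<^sub>0) \<le> C * norm (\<theta> - \<theta>\<^sub>0)"
    proof (rule field_differentiable_bound[where S = "cball \<theta>\<^sub>0 \<bar>\<theta> - \<theta>\<^sub>0\<bar>"])
      fix x assume "x \<in> cball \<theta>\<^sub>0 \<bar>\<theta> - \<theta>\<^sub>0\<bar>"
      note x = ball[OF this]
      show "(f y has_field_derivative df y x) (at x within cball \<theta>\<^sub>0 \<bar>\<theta> - \<theta>\<^sub>0\<bar>)"
        using f_deriv[OF y(1)] x ball by (blast intro: DERIV_subset)
      show "norm (df y x) \<le> C" using \<delta>(4)[OF conjunct2[OF x] y(1)] by simp
    qed (auto simp: dist_real_def)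
    also have "\<dots> \<le> C * (\<epsilon> / (2 * (C + 1)))"
      using \<theta> \<delta>(2) by (intro mult_left_mono) (auto simp: \<eta>_def)
    also have "\<dots> \<le> \<epsilon> / 2"
      using \<delta>(2) \<open>0 < \<epsilon>\<close> by (simp add: field_simps)
    finally have "\<bar>f y \<theta> - f y \<theta>\<^sub>0\<bar> \<le> \<epsilon> / 2"
      by simp
    moreover have "\<bar>f y \<theta>\<^sub>0 - f\<^sub>0\<bar> < \<epsilon> / 2"
      using \<rho>(2)[OF y(1)] y(2) by (simp add: \<eta>_def)
    ultimately show ?thesis
      by linarith
  qed
  ultimately show thesis using that by blast
qed

lemma local_parameter_tendsto: "(\<lambda>n. \<theta>\<^sub>0 + t / real n) \<longlonglongrightarrow> \<theta>\<^sub>0"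
  by (rule tendsto_eq_intros lim_const_over_n | simp)+

lemma eventually_local_parameter:
  assumes "0 < \<delta>"
  shows "\<forall>\<^sub>F n in sequentially. \<bar>(\<theta>\<^sub>0 + t / real n) - \<theta>\<^sub>0\<bar> < \<delta>"
  using tendstoD[OF local_parameter_tendsto assms] by (simp add: dist_real_def)

lemma eventually_local_parameter_in_T: "\<forall>\<^sub>F n in sequentially. \<theta>\<^sub>0 + t / real n \<in> T"
proof -
  obtain \<delta> where "0 < \<delta>" "\<And>\<theta>. \<bar>\<theta> - \<theta>\<^sub>0\<bar> < \<delta> \<Longrightarrow> \<theta> \<in> T"
    by (rule g_strict_mono_near, rule that)
  then show ?thesis
    using eventually_local_parameter[of \<delta> t] by (auto elim!: eventually_mono)
qed

lemma g_local_slope: "(\<lambda>n. real n * (g (\<theta>\<^sub>0 + t / real n) - g \<theta>\<^sub>0)) \<longlonglongrightarrow> t * dg \<theta>\<^sub>0"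
proof (cases "t = 0")
  case False
  have "(g has_real_derivative dg \<theta>\<^sub>0) (at \<theta>\<^sub>0)"
    using g_deriv \<theta>\<^sub>0_interior interior_subset[of T] by (metis at_within_interior subsetD)
  then have "((\<lambda>x. (g (\<theta>\<^sub>0 + x) - g \<theta>\<^sub>0) / x) \<longlongrightarrow> dg \<theta>\<^sub>0) (at 0)"
    by (simp add: DERIV_def)
  moreover have "filterlim (\<lambda>n. t / real n) (at 0) sequentially"
    unfolding filterlim_at using False
    by (auto intro!: lim_const_over_n eventually_sequentiallyI[of 1])
  ultimately have "(\<lambda>n. (g (\<theta>\<^sub>0 + t / real n) - g \<theta>\<^sub>0) / (t / real n)) \<longlonglongrightarrow> dg \<theta>\<^sub>0"
    by (rule filterlim_compose)
  from tendsto_mult[OF tendsto_const[of t] this] show ?thesis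
    using False by (simp add: mult.commute)
qed simp

section \<open>The mass near the boundary\<close>

lemma boundary_mass_bound:
  assumes \<theta>: "\<theta> \<in> T" and sub: "{g \<theta>..b} \<subseteq> \<Y>" and le: "g \<theta> \<le> b"
    and near: "\<And>y. g \<theta> \<le> y \<Longrightarrow> y \<le> b \<Longrightarrow> \<bar>f y \<theta> - c\<bar> \<le> \<epsilon>"
  shows "\<bar>measure (obs_law \<Y> f g \<theta>) {..<b} - c * (b - g \<theta>)\<bar> \<le> \<epsilon> * (b - g \<theta>)"
proof -
  have eq: "dens \<theta> y * indicator {..<b} y = f y \<theta> * indicator {g \<theta>..<b} y" for y
    using subsetD[OF sub, of y] by (auto simp: dens_def indicator_def)
  have P: "measure (obs_law \<Y> f g \<theta>) {..<b} = (\<integral>y. f y \<theta> * indicator {g \<theta>..<b} y \<partial>lborel)"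
    using measure_obs_law[OF \<theta>, of "{..<b}"] by (simp add: eq)
  have const: "integrable lborel (\<lambda>y. r * indicator {g \<theta>..<b} y)"
    "(\<integral>y. r * indicator {g \<theta>..<b} y \<partial>lborel) = r * (b - g \<theta>)" for r :: real
    using le by auto
  have int: "integrable lborel (\<lambda>y. f y \<theta> * indicator {g \<theta>..<b} y)"
    using integrable_mult_indicator[OF _ integrable_dens[OF \<theta>], of "{..<b}"]
    by (simp add: eq[symmetric] mult.commute)
  have "(\<integral>y. f y \<theta> * indicator {g \<theta>..<b} y \<partial>lborel)
      \<le> (\<integral>y. (c + \<epsilon>) * indicator {g \<theta>..<b} y \<partial>lborel)"
    using near by (intro integral_mono int const) (force simp: indicator_def abs_le_iff)
  moreover have "(\<integral>y. (c - \<epsilon>) * indicator {g \<theta>..<b} y \<partial>lborel)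
      \<le> (\<integral>y. f y \<theta> * indicator {g \<theta>..<b} y \<partial>lborel)"
    using near by (intro integral_mono int const) (force simp: indicator_def abs_le_iff)
  ultimately show ?thesis
    unfolding P const by (simp add: abs_le_iff algebra_simps)
qed

text \<open>
  The boundary moves by about \<open>(t - s) dg(\<theta>\<^sub>0) / n\<close>, and the density on the strip that it passes over is
  close to \<open>f\<^sub>0\<close>.
\<close>

lemma boundary_mass_tendsto:
  assumes "s \<le> t"
  shows "(\<lambda>n. real n * measure (obs_law \<Y> f g (\<theta>\<^sub>0 + s / real n)) {..<g (\<theta>\<^sub>0 + t / real n)})
    \<longlonglongrightarrow> (t - s) * (f\<^sub>0 * dg \<theta>\<^sub>0)"
proof -
  define P where
    "P n = measure (obs_law \<Y> f g (\<theta>\<^sub>0 + s / real n)) {..<g (\<theta>\<^sub>0 + t / real n)}" for n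
  define R where "R n = g (\<theta>\<^sub>0 + t / real n) - g (\<theta>\<^sub>0 + s / real n)" for n
  define L where "L = (t - s) * dg \<theta>\<^sub>0"
  have R: "(\<lambda>n. real n * R n) \<longlonglongrightarrow> L"
    using tendsto_diff[OF g_local_slope[of t] g_local_slope[of s]]
    by (simp add: R_def L_def algebra_simps)
  have "0 \<le> L" using assms dg_pos by (simp add: L_def)
  obtain \<delta> where \<delta>: "0 < \<delta>" "\<And>\<theta>. \<bar>\<theta> - \<theta>\<^sub>0\<bar> < \<delta> \<Longrightarrow> \<theta> \<in> T"
    "\<And>a b. \<bar>a - \<theta>\<^sub>0\<bar> < \<delta> \<Longrightarrow> \<bar>b - \<theta>\<^sub>0\<bar> < \<delta> \<Longrightarrow> a < b \<Longrightarrow> g a < g b"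
    "\<And>a b. \<bar>a - \<theta>\<^sub>0\<bar> < \<delta> \<Longrightarrow> \<bar>b - \<theta>\<^sub>0\<bar> < \<delta> \<Longrightarrow> a \<le> b \<Longrightarrow> {g a..g b} \<subseteq> \<Y>"
    by (rule g_strict_mono_near, rule that)
  have g0: "(\<lambda>n. g (\<theta>\<^sub>0 + t / real n)) \<longlonglongrightarrow> g \<theta>\<^sub>0" for t
  proof -
    have "(\<lambda>n. inverse (real n) * (real n * (g (\<theta>\<^sub>0 + t / real n) - g \<theta>\<^sub>0)) + g \<theta>\<^sub>0)
        \<longlonglongrightarrow> 0 * (t * dg \<theta>\<^sub>0) + g \<theta>\<^sub>0"
      by (intro tendsto_intros lim_inverse_n g_local_slope)
    then show ?thesis
      by (rule Lim_transform_eventually[OF tendsto_eq_rhs])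
         (auto intro!: eventually_sequentiallyI[of 1] simp: field_simps)
  qed
  have "(\<lambda>n. real n * P n - f\<^sub>0 * (real n * R n)) \<longlonglongrightarrow> 0"
  proof (rule tendstoI)
    fix e :: real assume "0 < e"
    \<comment> \<open>Eventually \<open>n R n < L + 1\<close>, which is positive even when \<open>s = t\<close>.\<close>
    define \<epsilon> where "\<epsilon> = e / (L + 1)"
    have "0 < \<epsilon>" using \<open>0 < e\<close> \<open>0 \<le> L\<close> by (simp add: \<epsilon>_def)
    obtain \<eta> where \<eta>: "0 < \<eta>"
      "\<And>\<theta> y. \<bar>\<theta> - \<theta>\<^sub>0\<bar> < \<eta> \<Longrightarrow> y \<in> \<Y> \<Longrightarrow> \<bar>y - g \<theta>\<^sub>0\<bar> < \<eta> \<Longrightarrow> \<bar>f y \<theta> - f\<^sub>0\<bar> \<le> \<epsilon>"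
      by (rule f_near_f\<^sub>0[OF \<open>0 < \<epsilon>\<close>], rule that)
    have "\<forall>\<^sub>F n in sequentially. real n * R n < L + 1"
      using order_tendstoD(2)[OF R, of "L + 1"] by simp
    then show "\<forall>\<^sub>F n in sequentially. dist (real n * P n - f\<^sub>0 * (real n * R n)) 0 < e"
      using eventually_local_parameter[OF \<delta>(1), of s] eventually_local_parameter[OF \<delta>(1), of t]
        eventually_local_parameter[OF \<eta>(1), of s] tendstoD[OF g0[of s] \<eta>(1)]
        tendstoD[OF g0[of t] \<eta>(1)] eventually_gt_at_top[of 0]
    proof eventually_elim
      case (elim n)
      have st: "\<theta>\<^sub>0 + s / real n \<le> \<theta>\<^sub>0 + t / real n"
        using assms by (simp add: divide_right_mono)
      have sub: "{g (\<theta>\<^sub>0 + s / real n)..g (\<theta>\<^sub>0 + t / real n)} \<subseteq> \<Y>"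
        using \<delta>(4)[OF elim(2,3) st] .
      have le: "g (\<theta>\<^sub>0 + s / real n) \<le> g (\<theta>\<^sub>0 + t / real n)"
        using \<delta>(3)[OF elim(2,3)] st by (cases "s = t") (auto simp: order_le_less)
      have "\<bar>P n - f\<^sub>0 * R n\<bar> \<le> \<epsilon> * R n"
        unfolding P_def R_def
      proof (rule boundary_mass_bound[OF \<delta>(2)[OF elim(2)] sub le])
        fix y assume "g (\<theta>\<^sub>0 + s / real n) \<le> y" "y \<le> g (\<theta>\<^sub>0 + t / real n)"
        then show "\<bar>f y (\<theta>\<^sub>0 + s / real n) - f\<^sub>0\<bar> \<le> \<epsilon>"
          using sub elim(5,6) by (intro \<eta>(2)[OF elim(4)]) (auto simp: dist_real_def)
      qed
      then have "real n * \<bar>P n - f\<^sub>0 * R n\<bar> \<le> \<epsilon> * (real n * R n)"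
        using mult_left_mono[of "\<bar>P n - f\<^sub>0 * R n\<bar>" "\<epsilon> * R n" "real n"] by (simp add: mult_ac)
      also have "\<dots> < \<epsilon> * (L + 1)"
        using elim(1) \<open>0 < \<epsilon>\<close> by simp
      also have "\<dots> = e"
        using \<open>0 \<le> L\<close> by (simp add: \<epsilon>_def)
      finally have "\<bar>real n * (P n - f\<^sub>0 * R n)\<bar> < e"
        by (simp add: abs_mult)
      then show ?case
        by (simp add: dist_real_def right_diff_distrib mult.left_commute)
    qed
  qed
  from tendsto_add[OF this tendsto_mult[OF tendsto_const[of f\<^sub>0] R]] show ?thesis
    by (simp add: P_def L_def mult_ac)
qed

section \<open>Rejection probabilities of tests based on the minimum\<close>

lemma prob_space_sample_law: "\<theta> \<in> T \<Longrightarrow> prob_space (sample_law \<Y> f g n \<theta>)"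
  unfolding sample_law_def by (intro prob_space_PiM density_prob)

lemma sets_sample_law [measurable_cong]:
  "sets (sample_law \<Y> f g n \<theta>) = sets (PiM {1..n} (\<lambda>_. borel))"
  unfolding sample_law_def by (intro sets_PiM_cong refl sets_obs_law)

lemma expectation_min_test:
  assumes \<theta>: "\<theta> \<in> T" and n: "0 < n"
  shows "(\<integral>y. (if Min (y ` {1..n}) < c then 1 else 0) \<partial>sample_law \<Y> f g n \<theta>)
    = 1 - (1 - measure (obs_law \<Y> f g \<theta>) {..<c}) ^ n"
proof -
  interpret obs: prob_space "obs_law \<Y> f g \<theta>" using density_prob \<theta> .
  interpret finite_product_prob_space "\<lambda>_. obs_law \<Y> f g \<theta>" "{1..n}"
    by standard auto
  interpret smpl: prob_space "sample_law \<Y> f g n \<theta>" using prob_space_sample_law \<theta> .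
  let ?A = "Pi\<^sub>E {1..n} (\<lambda>_. {c..})"
  have A: "?A \<in> sets (sample_law \<Y> f g n \<theta>)"
    unfolding sets_sample_law by (intro sets_PiM_I_finite) auto
  have "(\<integral>y. (if Min (y ` {1..n}) < c then 1 else 0) \<partial>sample_law \<Y> f g n \<theta>)
      = (\<integral>y. (1 - indicator ?A y :: real) \<partial>sample_law \<Y> f g n \<theta>)"
  proof (intro Bochner_Integration.integral_cong refl)
    fix y assume "y \<in> space (sample_law \<Y> f g n \<theta>)"
    then have "y \<in> extensional {1..n}"
      by (simp add: sample_law_def space_PiM PiE_def)
    moreover have "(Min (y ` {1..n}) < c) = (\<exists>i\<in>{1..n}. y i < c)"
      using n by (subst Min_less_iff) auto
    ultimately show "(if Min (y ` {1..n}) < c then 1 else 0) = (1 - indicator ?A y :: real)"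
      by (force simp: indicator_def PiE_iff not_less)
  qed
  also have "\<dots> = 1 - smpl.prob ?A"
  proof -
    have "integrable (sample_law \<Y> f g n \<theta>) (indicator ?A :: _ \<Rightarrow> real)"
      using A by (intro integrable_real_indicator) (auto simp: smpl.emeasure_eq_measure)
    then show ?thesis
      using A by (subst Bochner_Integration.integral_diff) (auto simp: smpl.prob_space)
  qed
  also have "smpl.prob ?A = obs.prob {c..} ^ n"
    unfolding sample_law_def by (subst prob_times) (auto simp: sets_obs_law)
  also have "obs.prob {c..} = 1 - obs.prob {..<c}"
  proof -
    have "obs.prob (space (obs_law \<Y> f g \<theta>) - {..<c}) = 1 - obs.prob {..<c}"
      by (rule obs.prob_compl) (simp add: sets_obs_law)
    moreover have "space (obs_law \<Y> f g \<theta>) - {..<c} = {c..}"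
      by (auto simp: obs_law_eq)
    ultimately show ?thesis by simp
  qed
  finally show ?thesis .
qed

abbreviation \<kappa> :: real where "\<kappa> \<equiv> boundary_scale \<theta>\<^sub>0 f g dg"

lemma scale_pos: "0 < \<kappa>"
  using f\<^sub>0_pos dg_pos by (simp add: boundary_scale_def)

text \<open>
  The rescaled minimum is asymptotically \<open>s\<close> plus an exponential variable of mean \<open>\<kappa>\<close>, seen
  through its distribution function at \<open>t\<close>.
\<close>

lemma min_test_rejection_tendsto:
  assumes "s \<le> t"
  shows "(\<lambda>n. \<integral>y. (if Min (y ` {1..n}) < g (\<theta>\<^sub>0 + t / real n) then 1 else 0)
      \<partial>sample_law \<Y> f g n (\<theta>\<^sub>0 + s / real n)) \<longlonglongrightarrow> 1 - exp (- (t - s) / \<kappa>)"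
proof -
  have "(\<lambda>n. 1 - (1 - measure (obs_law \<Y> f g (\<theta>\<^sub>0 + s / real n))
      {..<g (\<theta>\<^sub>0 + t / real n)}) ^ n) \<longlonglongrightarrow> 1 - exp (- ((t - s) * (f\<^sub>0 * dg \<theta>\<^sub>0)))"
    by (intro tendsto_intros one_minus_power_tendsto_exp boundary_mass_tendsto assms)
  moreover have "\<forall>\<^sub>F n in sequentially.
      1 - (1 - measure (obs_law \<Y> f g (\<theta>\<^sub>0 + s / real n)) {..<g (\<theta>\<^sub>0 + t / real n)}) ^ n
      = (\<integral>y. (if Min (y ` {1..n}) < g (\<theta>\<^sub>0 + t / real n) then 1 else 0)
          \<partial>sample_law \<Y> f g n (\<theta>\<^sub>0 + s / real n))"
    using eventually_local_parameter_in_T[of s] eventually_gt_at_top[of 0]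
    by eventually_elim (rule expectation_min_test[symmetric])
  ultimately have "(\<lambda>n. \<integral>y. (if Min (y ` {1..n}) < g (\<theta>\<^sub>0 + t / real n) then 1 else 0)
      \<partial>sample_law \<Y> f g n (\<theta>\<^sub>0 + s / real n)) \<longlonglongrightarrow> 1 - exp (- ((t - s) * (f\<^sub>0 * dg \<theta>\<^sub>0)))"
    by (rule Lim_transform_eventually)
  moreover have "- ((t - s) * (f\<^sub>0 * dg \<theta>\<^sub>0)) = - (t - s) / \<kappa>"
    by (simp add: boundary_scale_def divide_inverse algebra_simps)
  ultimately show ?thesis
    by (simp only:)
qed

lemma min_test_never_rejects:
  assumes "t \<le> s"
  shows "\<forall>\<^sub>F n in sequentially.
    (\<integral>y. (if Min (y ` {1..n}) < g (\<theta>\<^sub>0 + t / real n) then 1 else 0)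
      \<partial>sample_law \<Y> f g n (\<theta>\<^sub>0 + s / real n)) = (0 :: real)"
proof -
  obtain \<delta> where \<delta>: "0 < \<delta>" "\<And>\<theta>. \<bar>\<theta> - \<theta>\<^sub>0\<bar> < \<delta> \<Longrightarrow> \<theta> \<in> T"
    "\<And>a b. \<bar>a - \<theta>\<^sub>0\<bar> < \<delta> \<Longrightarrow> \<bar>b - \<theta>\<^sub>0\<bar> < \<delta> \<Longrightarrow> a < b \<Longrightarrow> g a < g b"
    by (rule g_strict_mono_near, rule that)
  show ?thesis
    using eventually_local_parameter[OF \<delta>(1), of s] eventually_local_parameter[OF \<delta>(1), of t]
      eventually_gt_at_top[of 0]
  proof eventually_elim
    case (elim n)
    have "\<theta>\<^sub>0 + t / real n \<le> \<theta>\<^sub>0 + s / real n"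
      using assms by (simp add: divide_right_mono)
    then have le: "g (\<theta>\<^sub>0 + t / real n) \<le> g (\<theta>\<^sub>0 + s / real n)"
      using \<delta>(3)[OF elim(2,1)] by (cases "s = t") (auto simp: order_le_less)
    have "measure (obs_law \<Y> f g (\<theta>\<^sub>0 + s / real n)) {..<g (\<theta>\<^sub>0 + t / real n)}
        = (\<integral>y. dens (\<theta>\<^sub>0 + s / real n) y * indicator {..<g (\<theta>\<^sub>0 + t / real n)} y \<partial>lborel)"
      by (intro measure_obs_law \<delta>(2) elim(1)) simp
    also have "(\<lambda>y. dens (\<theta>\<^sub>0 + s / real n) y * indicator {..<g (\<theta>\<^sub>0 + t / real n)} y) = (\<lambda>y. 0)"
      using le by (auto simp: dens_def indicator_def fun_eq_iff)
    finally show ?case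
      by (subst expectation_min_test[OF \<delta>(2)[OF elim(1)] elim(3)]) simp
  qed
qed

text \<open>
  For large \<open>n\<close> the maximum in the critical value is attained by its second argument, since \<open>g\<close>
  increases near \<open>\<theta>\<^sub>0\<close>.
\<close>

lemma phi_plus_eventually:
  assumes "0 < \<alpha>" "\<alpha> < 1"
  shows "\<forall>\<^sub>F n in sequentially. phi_plus \<theta>\<^sub>0 f g dg \<alpha> n
    = (\<lambda>y. if Min (y ` {1..n}) < g (\<theta>\<^sub>0 + \<kappa> * ln (1 / (1 - \<alpha>)) / real n) then 1 else 0)"
proof -
  have t: "0 < \<kappa> * ln (1 / (1 - \<alpha>))"
    using assms scale_pos by simp
  obtain \<delta> where \<delta>: "0 < \<delta>" "\<And>\<theta>. \<bar>\<theta> - \<theta>\<^sub>0\<bar> < \<delta> \<Longrightarrow> \<theta> \<in> T"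
    "\<And>a b. \<bar>a - \<theta>\<^sub>0\<bar> < \<delta> \<Longrightarrow> \<bar>b - \<theta>\<^sub>0\<bar> < \<delta> \<Longrightarrow> a < b \<Longrightarrow> g a < g b"
    by (rule g_strict_mono_near, rule that)
  show ?thesis
    using eventually_local_parameter[OF \<delta>(1), of "\<kappa> * ln (1 / (1 - \<alpha>))"] eventually_gt_at_top[of 0]
  proof eventually_elim
    case (elim n)
    have "g \<theta>\<^sub>0 < g (\<theta>\<^sub>0 + \<kappa> * ln (1 / (1 - \<alpha>)) / real n)"
      using elim t \<delta>(1) by (intro \<delta>(3)) auto
    then show ?case
      by (intro ext) (simp add: phi_plus_def max_def)
  qed
qed

lemma is_test_phi_plus: "is_test n (phi_plus \<theta>\<^sub>0 f g dg \<alpha> n)"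
proof -
  define c where "c = max (g \<theta>\<^sub>0) (g (\<theta>\<^sub>0 + \<kappa> / real n * ln (1 / (1 - \<alpha>))))"
  have eq: "phi_plus \<theta>\<^sub>0 f g dg \<alpha> n = (\<lambda>y. if Min (y ` {1..n}) < c then 1 else 0)"
    by (simp add: phi_plus_def c_def fun_eq_iff)
  have "(\<lambda>y. if Min (y ` {1..n}) < c then 1 else 0 :: real)
      \<in> borel_measurable (PiM {1..n} (\<lambda>_. borel))"
  proof (cases "n = 0")
    case False
    have *: "(Min (y ` {1..n}) < c) = (\<exists>i\<in>{1..n}. y i < c)" for y :: "nat \<Rightarrow> real"
      using False by (subst Min_less_iff) auto
    show ?thesis unfolding * by measurable
  qed simp
  then show ?thesis by (simp add: is_test_def eq)
qed

section \<open>Hellinger distance above the null boundary\<close>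

text \<open>
  Usable form of the second moment condition. The parameter at which the Fisher information
  is evaluated may depend on \<open>y\<close>, as it does when it comes from the mean value theorem; this
  is what the supremum under the integral is for. The supremum may fail to be measurable, but
  the nonnegative integral is monotone for arbitrary functions.
\<close>

lemma information_bound:
  obtains \<delta> K where "0 < \<delta>" "K < \<infinity>"
    "\<forall>F. (\<forall>y\<in>\<Y>. g \<theta>\<^sub>0 \<le> y \<longrightarrow>
        (\<exists>\<theta>. \<bar>\<theta> - \<theta>\<^sub>0\<bar> < \<delta> \<and> g \<theta> \<le> y \<and> F y \<le> (df y \<theta>)\<^sup>2 / f y \<theta>)) \<longrightarrow>
      (\<integral>\<^sup>+y. ennreal (F y) * indicator {y \<in> \<Y>. g \<theta>\<^sub>0 \<le> y} y \<partial>lborel) \<le> K"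
proof -
  obtain N where N: "open N" "\<theta>\<^sub>0 \<in> N" "\<forall>y\<in>\<Y>. \<forall>\<theta>\<in>N. 0 < f y \<theta>"
    and K: "(\<integral>\<^sup>+y\<in>\<Y>. (SUP (\<theta>, \<theta>')\<in>N \<times> N.
      ennreal (\<bar>df y \<theta>'\<bar>\<^sup>2 / (f y \<theta>')\<^sup>2 * indicator {g \<theta>..} y * f y \<theta>)) \<partial>lborel) < \<infinity>"
    using neighbourhood by blast
  obtain \<delta> where \<delta>: "0 < \<delta>" "ball \<theta>\<^sub>0 \<delta> \<subseteq> N"
    using N openE by blast
  show thesis
  proof (rule that[OF \<delta>(1) K], intro allI impI)
    fix F :: "real \<Rightarrow> real"
    assume F: "\<forall>y\<in>\<Y>. g \<theta>\<^sub>0 \<le> y \<longrightarrow>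
      (\<exists>\<theta>. \<bar>\<theta> - \<theta>\<^sub>0\<bar> < \<delta> \<and> g \<theta> \<le> y \<and> F y \<le> (df y \<theta>)\<^sup>2 / f y \<theta>)"
    show "(\<integral>\<^sup>+y. ennreal (F y) * indicator {y \<in> \<Y>. g \<theta>\<^sub>0 \<le> y} y \<partial>lborel)
      \<le> (\<integral>\<^sup>+y\<in>\<Y>. (SUP (\<theta>, \<theta>')\<in>N \<times> N.
          ennreal (\<bar>df y \<theta>'\<bar>\<^sup>2 / (f y \<theta>')\<^sup>2 * indicator {g \<theta>..} y * f y \<theta>)) \<partial>lborel)"
    proof (rule nn_integral_mono)
      fix y
      show "ennreal (F y) * indicator {y \<in> \<Y>. g \<theta>\<^sub>0 \<le> y} y
        \<le> (SUP (\<theta>, \<theta>')\<in>N \<times> N.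
          ennreal (\<bar>df y \<theta>'\<bar>\<^sup>2 / (f y \<theta>')\<^sup>2 * indicator {g \<theta>..} y * f y \<theta>)) * indicator \<Y> y"
      proof (cases "y \<in> \<Y> \<and> g \<theta>\<^sub>0 \<le> y")
        case True
        then obtain \<theta> where \<theta>: "\<bar>\<theta> - \<theta>\<^sub>0\<bar> < \<delta>" "g \<theta> \<le> y" "F y \<le> (df y \<theta>)\<^sup>2 / f y \<theta>"
          using F by blast
        then have "\<theta> \<in> N" using \<delta>(2) by (auto simp: dist_real_def)
        then have "0 < f y \<theta>" using N(3) True by blast
        have "ennreal (F y)
            \<le> ennreal (\<bar>df y \<theta>\<bar>\<^sup>2 / (f y \<theta>)\<^sup>2 * indicator {g \<theta>..} y * f y \<theta>)"
          using \<theta>(2,3) \<open>0 < f y \<theta>\<close>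
          by (intro ennreal_leI) (simp add: power2_eq_square field_simps)
        also have "\<dots> \<le> (SUP (\<theta>, \<theta>')\<in>N \<times> N.
            ennreal (\<bar>df y \<theta>'\<bar>\<^sup>2 / (f y \<theta>')\<^sup>2 * indicator {g \<theta>..} y * f y \<theta>))"
          using \<open>\<theta> \<in> N\<close> by (intro SUP_upper2[of "(\<theta>, \<theta>)"]) auto
        finally show ?thesis using True by simp
      qed auto
    qed
  qed
qed

text \<open>
  Alternatives \<open>h < 0\<close> overlap with the null only above \<open>g \<theta>\<^sub>0\<close>, so likelihoods are compared on this
  part, which is a density for \<open>\<theta> = \<theta>\<^sub>0\<close> and in general a subdensity.
\<close>

definition dens_above :: "real \<Rightarrow> real \<Rightarrow> real" where
  "dens_above \<theta> y = dens \<theta> y * indicator {g \<theta>\<^sub>0..} y"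

lemma dens_above_nonneg: "\<theta> \<in> T \<Longrightarrow> 0 \<le> dens_above \<theta> y"
  by (simp add: dens_above_def dens_nonneg)

lemma dens_above_le_dens: "\<theta> \<in> T \<Longrightarrow> dens_above \<theta> y \<le> dens \<theta> y"
  by (auto simp: dens_above_def dens_nonneg indicator_def)

lemma dens_above_\<theta>\<^sub>0: "dens_above \<theta>\<^sub>0 = dens \<theta>\<^sub>0"
  by (auto simp: dens_above_def dens_def indicator_def fun_eq_iff)

lemma \<theta>\<^sub>0_in_T: "\<theta>\<^sub>0 \<in> T"
  using \<theta>\<^sub>0_interior interior_subset by blast

lemma
  assumes "\<theta> \<in> T"
  shows integrable_dens_above: "integrable lborel (dens_above \<theta>)"
    and integral_dens_above: "(\<integral>y. dens_above \<theta> y \<partial>lborel) = 1 - measure (obs_law \<Y> f g \<theta>) {..<g \<theta>\<^sub>0}"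
proof -
  have below: "integrable lborel (\<lambda>y. dens \<theta> y * indicator {..<g \<theta>\<^sub>0} y)"
    using integrable_mult_indicator[OF _ integrable_dens[OF assms], of "{..<g \<theta>\<^sub>0}"]
    by (simp add: mult.commute)
  have eq: "dens_above \<theta> = (\<lambda>y. dens \<theta> y - dens \<theta> y * indicator {..<g \<theta>\<^sub>0} y)"
    by (auto simp: dens_above_def indicator_def fun_eq_iff)
  show "integrable lborel (dens_above \<theta>)"
    unfolding eq using below integrable_dens[OF assms] by simp
  show "(\<integral>y. dens_above \<theta> y \<partial>lborel) = 1 - measure (obs_law \<Y> f g \<theta>) {..<g \<theta>\<^sub>0}"
    unfolding eq using below integrable_dens[OF assms]
    by (simp add: measure_obs_law assms integral_dens)
qed

lemma hellinger_above:
  assumes \<theta>: "\<theta> \<in> T"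
  shows "integrable lborel (\<lambda>y. (sqrt (dens_above \<theta> y) - sqrt (dens_above \<theta>\<^sub>0 y))\<^sup>2)" (is ?int)
    and "(\<integral>y. sqrt (dens_above \<theta> y * dens_above \<theta>\<^sub>0 y) \<partial>lborel)
      = 1 - (measure (obs_law \<Y> f g \<theta>) {..<g \<theta>\<^sub>0}
        + (\<integral>y. (sqrt (dens_above \<theta> y) - sqrt (dens_above \<theta>\<^sub>0 y))\<^sup>2 \<partial>lborel)) / 2" (is ?eq)
proof -
  have eq: "(sqrt (dens_above \<theta> y) - sqrt (dens_above \<theta>\<^sub>0 y))\<^sup>2
      = dens_above \<theta> y + dens_above \<theta>\<^sub>0 y - 2 * sqrt (dens_above \<theta> y * dens_above \<theta>\<^sub>0 y)" for y
    using dens_above_nonneg[OF \<theta>, of y] dens_above_nonneg[OF \<theta>\<^sub>0_in_T, of y]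
    by (simp add: power2_diff real_sqrt_mult)
  have 1: "integrable lborel (\<lambda>y. sqrt (dens_above \<theta> y * dens_above \<theta>\<^sub>0 y))"
    by (intro integrable_sqrt_mult integrable_dens_above dens_above_nonneg \<theta> \<theta>\<^sub>0_in_T)
  note ints = 1 integrable_dens_above[OF \<theta>] integrable_dens_above[OF \<theta>\<^sub>0_in_T]
  show ?int unfolding eq using ints by simp
  have "(\<integral>y. dens_above \<theta>\<^sub>0 y \<partial>lborel) = 1"
    by (simp add: dens_above_\<theta>\<^sub>0 integral_dens \<theta>\<^sub>0_in_T)
  then show ?eq unfolding eq using ints integral_dens_above[OF \<theta>] by (simp add: field_simps)
qed

text \<open>
  The square root of the density has derivative \<open>df / (2 sqrt f)\<close>, whose square is a quarter of the
  integrand \<open>df\<^sup>2 / f\<close> of the Fisher information.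
\<close>

lemma sqrt_increment:
  assumes "a < b" and "y \<in> \<Y>"
    and seg: "\<And>x. a \<le> x \<Longrightarrow> x \<le> b \<Longrightarrow> x \<in> interior T \<and> 0 < f y x"
  obtains \<xi> where "a < \<xi>" "\<xi> < b"
    "(sqrt (f y b) - sqrt (f y a))\<^sup>2 = (b - a)\<^sup>2 / 4 * ((df y \<xi>)\<^sup>2 / f y \<xi>)"
proof -
  have "\<exists>\<xi>>a. \<xi> < b \<and> sqrt (f y b) - sqrt (f y a) = (b - a) * (df y \<xi> * (inverse (sqrt (f y \<xi>)) / 2))"
  proof (rule MVT2[OF \<open>a < b\<close>])
    fix x assume "a \<le> x" "x \<le> b"
    note x = seg[OF this]
    have "(f y has_real_derivative df y x) (at x)"
      using f_deriv[OF \<open>y \<in> \<Y>\<close>, of x] x by (metis at_within_interior interior_subset subsetD)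
    from DERIV_chain2[OF DERIV_real_sqrt this] x
    show "((\<lambda>x. sqrt (f y x)) has_real_derivative df y x * (inverse (sqrt (f y x)) / 2)) (at x)"
      by (simp add: mult.commute)
  qed
  then obtain \<xi> where \<xi>: "a < \<xi>" "\<xi> < b"
    "sqrt (f y b) - sqrt (f y a) = (b - a) * (df y \<xi> * (inverse (sqrt (f y \<xi>)) / 2))"
    by blast
  have "0 < f y \<xi>" using seg \<xi> by simp
  then have sq: "(inverse (sqrt (f y \<xi>)))\<^sup>2 = 1 / f y \<xi>"
    by (simp add: inverse_eq_divide power_divide)
  have "((b - a) * (df y \<xi> * (inverse (sqrt (f y \<xi>)) / 2)))\<^sup>2
      = (b - a)\<^sup>2 / 4 * ((df y \<xi>)\<^sup>2 / f y \<xi>)"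
    by (simp only: power_mult_distrib power_divide sq) simp
  with that \<xi> show thesis by metis
qed

text \<open>
  The squared Hellinger distance is at most \<open>(h/n)\<^sup>2 K / 4\<close>, where \<open>K\<close> bounds the Fisher information, so
  it vanishes even after multiplication by \<open>n\<close>.
\<close>

lemma hellinger_rate:
  assumes "h < 0"
  shows "(\<lambda>n. real n *
      (\<integral>y. (sqrt (dens_above (\<theta>\<^sub>0 + h / real n) y) - sqrt (dens_above \<theta>\<^sub>0 y))\<^sup>2 \<partial>lborel)) \<longlonglongrightarrow> 0"
proof -
  obtain \<delta>1 K where K: "0 < \<delta>1" "K < \<infinity>"
    "\<forall>F. (\<forall>y\<in>\<Y>. g \<theta>\<^sub>0 \<le> y \<longrightarrow>
        (\<exists>\<theta>. \<bar>\<theta> - \<theta>\<^sub>0\<bar> < \<delta>1 \<and> g \<theta> \<le> y \<and> F y \<le> (df y \<theta>)\<^sup>2 / f y \<theta>)) \<longrightarrow>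
      (\<integral>\<^sup>+y. ennreal (F y) * indicator {y \<in> \<Y>. g \<theta>\<^sub>0 \<le> y} y \<partial>lborel) \<le> K"
    by (rule information_bound, rule that)
  obtain \<delta>2 C where reg: "0 < \<delta>2" "0 \<le> C"
    "\<And>\<theta>. \<bar>\<theta> - \<theta>\<^sub>0\<bar> < \<delta>2 \<Longrightarrow> \<theta> \<in> interior T \<and> g \<theta> \<in> \<Y> \<and> 0 < dg \<theta>"
    "\<And>\<theta> y. \<bar>\<theta> - \<theta>\<^sub>0\<bar> < \<delta>2 \<Longrightarrow> y \<in> \<Y> \<Longrightarrow> 0 < f y \<theta> \<and> \<bar>df y \<theta>\<bar> \<le> C"
    by (rule regular_ball, rule that)
  obtain \<delta>3 where mono: "0 < \<delta>3" "\<And>\<theta>. \<bar>\<theta> - \<theta>\<^sub>0\<bar> < \<delta>3 \<Longrightarrow> \<theta> \<in> T"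
    "\<And>a b. \<bar>a - \<theta>\<^sub>0\<bar> < \<delta>3 \<Longrightarrow> \<bar>b - \<theta>\<^sub>0\<bar> < \<delta>3 \<Longrightarrow> a < b \<Longrightarrow> g a < g b"
    by (rule g_strict_mono_near, rule that)
  define I where
    "I \<theta> = (\<integral>y. (sqrt (dens_above \<theta> y) - sqrt (dens_above \<theta>\<^sub>0 y))\<^sup>2 \<partial>lborel)" for \<theta>
  have nonneg: "0 \<le> I \<theta>" for \<theta>
    by (simp add: I_def)
  have bound: "I \<theta> \<le> (\<theta>\<^sub>0 - \<theta>)\<^sup>2 / 4 * enn2real K"
    if \<theta>: "\<theta> < \<theta>\<^sub>0" and near: "\<bar>\<theta> - \<theta>\<^sub>0\<bar> < \<delta>1" "\<bar>\<theta> - \<theta>\<^sub>0\<bar> < \<delta>2" "\<bar>\<theta> - \<theta>\<^sub>0\<bar> < \<delta>3" for \<theta>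
  proof -
    \<comment> \<open>The integrand is scaled up to the information \<open>df\<^sup>2 / f\<close>, rather than the supremum scaled
        down: constants can be moved out of an integral only for measurable integrands.\<close>
    define F where "F y = 4 / (\<theta>\<^sub>0 - \<theta>)\<^sup>2 * (sqrt (dens_above \<theta> y) - sqrt (dens_above \<theta>\<^sub>0 y))\<^sup>2" for y
    have \<theta>T: "\<theta> \<in> T" using mono(2) near by blast
    have "g \<theta> < g \<theta>\<^sub>0" using mono near \<theta> by auto
    have F_outside: "F y = 0" if "y \<notin> {y \<in> \<Y>. g \<theta>\<^sub>0 \<le> y}" for y
      using that by (auto simp: F_def dens_above_def dens_def indicator_def)
    have int: "integrable lborel F"
      unfolding F_def by (intro integrable_mult_right hellinger_above(1) \<theta>T)
    have "ennreal (\<integral>y. F y \<partial>lborel) = (\<integral>\<^sup>+y. ennreal (F y) \<partial>lborel)"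
      by (rule nn_integral_eq_integral[symmetric, OF int]) (simp add: F_def)
    also have "\<dots> = (\<integral>\<^sup>+y. ennreal (F y) * indicator {y \<in> \<Y>. g \<theta>\<^sub>0 \<le> y} y \<partial>lborel)"
      by (intro nn_integral_cong) (auto simp: indicator_def F_outside)
    also have "\<dots> \<le> K"
    proof (rule K(3)[rule_format])
      fix y assume y: "y \<in> \<Y>" "g \<theta>\<^sub>0 \<le> y"
      have seg: "x \<in> interior T \<and> 0 < f y x" if "\<theta> \<le> x" "x \<le> \<theta>\<^sub>0" for x
        using reg(3)[of x] reg(4)[of x y] y that near by auto
      obtain \<xi> where \<xi>: "\<theta> < \<xi>" "\<xi> < \<theta>\<^sub>0"
        "(sqrt (f y \<theta>\<^sub>0) - sqrt (f y \<theta>))\<^sup>2 = (\<theta>\<^sub>0 - \<theta>)\<^sup>2 / 4 * ((df y \<xi>)\<^sup>2 / f y \<xi>)"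
        by (rule sqrt_increment[OF \<theta> y(1)], erule (1) seg, rule that)
      have "dens_above \<theta> y = f y \<theta>" "dens_above \<theta>\<^sub>0 y = f y \<theta>\<^sub>0"
        using y \<open>g \<theta> < g \<theta>\<^sub>0\<close> by (auto simp: dens_above_def dens_def)
      then have "F y = 4 / (\<theta>\<^sub>0 - \<theta>)\<^sup>2 * (sqrt (f y \<theta>\<^sub>0) - sqrt (f y \<theta>))\<^sup>2"
        by (simp add: F_def power2_commute)
      also have "\<dots> = (df y \<xi>)\<^sup>2 / f y \<xi>"
        unfolding \<xi>(3) using \<theta> by simp
      finally have "F y = (df y \<xi>)\<^sup>2 / f y \<xi>" .
      moreover have "g \<xi> < g \<theta>\<^sub>0" using mono \<xi> near by auto
      ultimately show "\<exists>\<theta>. \<bar>\<theta> - \<theta>\<^sub>0\<bar> < \<delta>1 \<and> g \<theta> \<le> y \<and> F y \<le> (df y \<theta>)\<^sup>2 / f y \<theta>"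
        using \<xi> near y by (intro exI[of _ \<xi>]) auto
    qed
    finally have "(\<integral>y. F y \<partial>lborel) \<le> enn2real K"
      using K(2) by (metis enn2real_leI ennreal_enn2real enn2real_nonneg ennreal_le_iff infinity_ennreal_def)
    then have "4 / (\<theta>\<^sub>0 - \<theta>)\<^sup>2 * I \<theta> \<le> enn2real K"
      by (simp add: F_def I_def)
    then show ?thesis using \<theta> by (simp add: field_simps)
  qed
  have "(\<lambda>n. h\<^sup>2 / 4 * enn2real K / real n) \<longlonglongrightarrow> 0"
    by (rule lim_const_over_n)
  then have "(\<lambda>n. real n * I (\<theta>\<^sub>0 + h / real n)) \<longlonglongrightarrow> 0"
  proof (rule Lim_null_comparison[rotated])
    show "\<forall>\<^sub>F n in sequentially.
        norm (real n * I (\<theta>\<^sub>0 + h / real n)) \<le> h\<^sup>2 / 4 * enn2real K / real n"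
      using eventually_local_parameter[OF K(1), of h] eventually_local_parameter[OF reg(1), of h]
        eventually_local_parameter[OF mono(1), of h] eventually_gt_at_top[of 0]
    proof eventually_elim
      case (elim n)
      have "h / real n < 0"
        using assms elim(4) by (intro divide_neg_pos) auto
      then have "I (\<theta>\<^sub>0 + h / real n) \<le> (\<theta>\<^sub>0 - (\<theta>\<^sub>0 + h / real n))\<^sup>2 / 4 * enn2real K"
        by (intro bound elim) simp
      also have "\<dots> = (h / real n)\<^sup>2 / 4 * enn2real K"
        by simp
      finally have "real n * I (\<theta>\<^sub>0 + h / real n) \<le> real n * ((h / real n)\<^sup>2 / 4 * enn2real K)"
        by (intro mult_left_mono) auto
      then show ?case
        using elim(4) nonneg by (simp add: power2_eq_square)
    qed
  qed
  then show ?thesis by (simp add: I_def)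
qed

section \<open>The power envelope\<close>

lemma expectation_sample_law:
  assumes \<theta>: "\<theta> \<in> T" and w [measurable]: "w \<in> borel_measurable (PiM {1..n} (\<lambda>_. borel))"
  shows "(\<integral>y. w y \<partial>sample_law \<Y> f g n \<theta>)
    = (\<integral>y. w y * (\<Prod>i\<in>{1..n}. dens \<theta> (y i)) \<partial>PiM {1..n} (\<lambda>_. lborel))"
proof -
  have [measurable]: "dens \<theta> \<in> borel_measurable borel" using \<theta> by measurable
  have [measurable]: "w \<in> borel_measurable (PiM {1..n} (\<lambda>_. lborel))"
    using w by (simp cong: measurable_cong_sets sets_PiM_cong)
  have "sample_law \<Y> f g n \<theta>
      = density (PiM {1..n} (\<lambda>_. lborel)) (\<lambda>y. \<Prod>i\<in>{1..n}. ennreal (dens \<theta> (y i)))"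
    unfolding sample_law_def obs_law_eq
    using density_prob[OF \<theta>] by (intro PiM_density) (auto simp: obs_law_eq sigma_finite_lborel)
  also have "\<dots> = density (PiM {1..n} (\<lambda>_. lborel)) (\<lambda>y. ennreal (\<Prod>i\<in>{1..n}. dens \<theta> (y i)))"
    using \<theta> by (intro arg_cong[where f = "density _"] ext) (simp add: prod_ennreal dens_nonneg)
  finally have eq: "sample_law \<Y> f g n \<theta>
      = density (PiM {1..n} (\<lambda>_. lborel)) (\<lambda>y. ennreal (\<Prod>i\<in>{1..n}. dens \<theta> (y i)))" .
  show ?thesis
    unfolding eq
  proof (subst integral_real_density)
    show "(\<lambda>y. \<Prod>i\<in>{1..n}. dens \<theta> (y i)) \<in> borel_measurable (PiM {1..n} (\<lambda>_. lborel))"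
      by measurable
    show "AE y in PiM {1..n} (\<lambda>_. lborel). 0 \<le> (\<Prod>i\<in>{1..n}. dens \<theta> (y i))"
      by (intro AE_I2 prod_nonneg dens_nonneg \<theta>)
  qed (use \<open>w \<in> borel_measurable (PiM {1..n} (\<lambda>_. lborel))\<close> in \<open>simp_all add: mult.commute\<close>)
qed

text \<open>
  The alternative is replaced by its part above \<open>g \<theta>\<^sub>0\<close>, which only lowers the acceptance
  probability. Discarding the rest is essential: there the null has no mass, so the likelihoods
  are not close to being proportional.
\<close>

lemma acceptance_comparison:
  assumes \<theta>: "\<theta> \<in> T" and w: "w \<in> borel_measurable (PiM {1..n} (\<lambda>_. borel))"
    and w01: "\<And>y. y \<in> space (PiM {1..n} (\<lambda>_. borel)) \<Longrightarrow> 0 \<le> w y \<and> w y \<le> 1"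
    and "0 \<le> c" and "0 < k"
  shows "c * (\<integral>y. w y \<partial>sample_law \<Y> f g n \<theta>\<^sub>0) \<le> (\<integral>y. w y \<partial>sample_law \<Y> f g n \<theta>) + k * c
    + ((\<integral>y. dens_above \<theta> y \<partial>lborel) ^ n + c
      - 2 * sqrt c * (\<integral>y. sqrt (dens_above \<theta> y * dens_above \<theta>\<^sub>0 y) \<partial>lborel) ^ n) / k"
proof -
  let ?M = "PiM {1..n} (\<lambda>_. lborel :: real measure)"
  define A where "A \<theta> y = (\<Prod>i\<in>{1..n}. dens_above \<theta> (y i))" for \<theta> and y :: "nat \<Rightarrow> real"
  have sqrt_prod: "sqrt (\<Prod>i\<in>I. u i) = (\<Prod>i\<in>I. sqrt (u i))" for u :: "nat \<Rightarrow> real" and I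
    by (induction I rule: infinite_finite_induct) (auto simp: real_sqrt_mult)
  interpret product_sigma_finite "\<lambda>_ :: nat. lborel :: real measure"
    by standard
  have wM [measurable]: "w \<in> borel_measurable ?M"
    using w by (simp cong: measurable_cong_sets sets_PiM_cong)
  have spc: "space ?M = space (PiM {1..n} (\<lambda>_. borel))"
    by (simp add: space_PiM)
  have A_nonneg: "0 \<le> A \<theta> y" if "\<theta> \<in> T" for \<theta> y
    using that by (auto simp: A_def intro!: prod_nonneg dens_above_nonneg)
  have A_int: "integrable ?M (A \<theta>)" if "\<theta> \<in> T" for \<theta>
    unfolding A_def using that by (intro product_integrable_prod integrable_dens_above) auto
  have A_eq: "(\<integral>y. A \<theta> y \<partial>?M) = (\<integral>y. dens_above \<theta> y \<partial>lborel) ^ n" if "\<theta> \<in> T" for \<theta>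
    unfolding A_def using that by (subst product_integral_prod) (auto intro: integrable_dens_above)
  have AA_eq: "(\<integral>y. sqrt (A \<theta> y * A \<theta>\<^sub>0 y) \<partial>?M)
      = (\<integral>y. sqrt (dens_above \<theta> y * dens_above \<theta>\<^sub>0 y) \<partial>lborel) ^ n"
  proof -
    have "integrable lborel (\<lambda>y. sqrt (dens_above \<theta> y * dens_above \<theta>\<^sub>0 y))"
      by (intro integrable_sqrt_mult integrable_dens_above dens_above_nonneg \<theta> \<theta>\<^sub>0_in_T)
    moreover have "sqrt (A \<theta> y * A \<theta>\<^sub>0 y)
        = (\<Prod>i\<in>{1..n}. sqrt (dens_above \<theta> (y i) * dens_above \<theta>\<^sub>0 (y i)))" for y
      by (simp add: A_def prod.distrib real_sqrt_mult sqrt_prod)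
    ultimately show ?thesis
      using product_integral_prod[of "{1..n}" "\<lambda>_ y. sqrt (dens_above \<theta> y * dens_above \<theta>\<^sub>0 y)"] by simp
  qed
  have "c * (\<integral>y. w y * A \<theta>\<^sub>0 y \<partial>?M) \<le> (\<integral>y. w y * A \<theta> y \<partial>?M) + k * c * (\<integral>y. A \<theta>\<^sub>0 y \<partial>?M)
    + ((\<integral>y. A \<theta> y \<partial>?M) + c * (\<integral>y. A \<theta>\<^sub>0 y \<partial>?M)
      - 2 * sqrt c * (\<integral>y. sqrt (A \<theta> y * A \<theta>\<^sub>0 y) \<partial>?M)) / k"
    using w01 assms(4,5) unfolding spc[symmetric]
    by (intro affinity_comparison A_int A_nonneg \<theta> \<theta>\<^sub>0_in_T wM) auto
  moreover have "(\<integral>y. A \<theta>\<^sub>0 y \<partial>?M) = 1"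
    unfolding A_eq[OF \<theta>\<^sub>0_in_T] by (simp add: dens_above_\<theta>\<^sub>0 integral_dens \<theta>\<^sub>0_in_T)
  moreover have "(\<integral>y. w y * A \<theta>\<^sub>0 y \<partial>?M) = (\<integral>y. w y \<partial>sample_law \<Y> f g n \<theta>\<^sub>0)"
    by (simp only: expectation_sample_law[OF \<theta>\<^sub>0_in_T w] A_def dens_above_\<theta>\<^sub>0)
  moreover have "(\<integral>y. w y * A \<theta> y \<partial>?M) \<le> (\<integral>y. w y \<partial>sample_law \<Y> f g n \<theta>)"
    unfolding expectation_sample_law[OF \<theta> w]
  proof (rule integral_mono)
    have bounded: "integrable ?M (\<lambda>y. w y * u y)" if "integrable ?M u" for u
    proof (rule Bochner_Integration.integrable_bound[OF that])
      show "(\<lambda>y. w y * u y) \<in> borel_measurable ?M"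
        using that by measurable
      show "AE y in ?M. norm (w y * u y) \<le> norm (u y)"
      proof (rule AE_I2)
        fix y assume "y \<in> space ?M"
        then have "0 \<le> w y \<and> w y \<le> 1" using w01 unfolding spc by blast
        then show "norm (w y * u y) \<le> norm (u y)"
          by (auto simp: abs_mult intro!: mult_left_le_one_le)
      qed
    qed
    show "integrable ?M (\<lambda>y. w y * A \<theta> y)"
      by (intro bounded A_int \<theta>)
    show "integrable ?M (\<lambda>y. w y * (\<Prod>i\<in>{1..n}. dens \<theta> (y i)))"
      by (intro bounded product_integrable_prod integrable_dens \<theta>) auto
  next
    fix y assume "y \<in> space ?M"
    then have "0 \<le> w y" using w01 spc by auto
    moreover have "A \<theta> y \<le> (\<Prod>i\<in>{1..n}. dens \<theta> (y i))"
      unfolding A_def by (intro prod_mono conjI dens_above_nonneg dens_above_le_dens \<theta>)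
    ultimately show "w y * A \<theta> y \<le> w y * (\<Prod>i\<in>{1..n}. dens \<theta> (y i))"
      by (intro mult_left_mono)
  qed
  ultimately show ?thesis
    unfolding A_eq[OF \<theta>] AA_eq by simp
qed

text \<open>
  Acceptance probabilities are compared with the factor \<open>exp (h / \<kappa>)\<close>, the limit of the likelihood
  ratio above \<open>g \<theta>\<^sub>0\<close>; for this factor the affinity term \<open>D n\<close> vanishes in the limit. It involves the
  two laws but not the test, so one error sequence serves all tests.
\<close>

lemma power_envelope:
  assumes "h < 0"
  obtains r :: "nat \<Rightarrow> real" where "r \<longlonglongrightarrow> 0"
    "\<forall>\<^sub>F n in sequentially. \<forall>\<psi>. is_test n \<psi> \<longrightarrow>
      (\<integral>y. \<psi> y \<partial>sample_law \<Y> f g n (\<theta>\<^sub>0 + h / real n))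
        \<le> 1 - exp (h / \<kappa>) + exp (h / \<kappa>) * (\<integral>y. \<psi> y \<partial>sample_law \<Y> f g n \<theta>\<^sub>0) + r n"
proof -
  define c where "c = exp (h / \<kappa>)"
  have "0 < c" by (simp add: c_def)
  have sqrt_c: "sqrt c = exp (h / \<kappa> / 2)"
    by (rule real_sqrt_unique) (simp_all add: c_def power2_eq_square flip: exp_add)
  define p where "p n = measure (obs_law \<Y> f g (\<theta>\<^sub>0 + h / real n)) {..<g \<theta>\<^sub>0}" for n
  define H where
    "H n = (\<integral>y. (sqrt (dens_above (\<theta>\<^sub>0 + h / real n) y) - sqrt (dens_above \<theta>\<^sub>0 y))\<^sup>2 \<partial>lborel)" for n
  define D where "D n = (1 - p n) ^ n + c - 2 * sqrt c * (1 - (p n + H n) / 2) ^ n" for n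
  have p: "(\<lambda>n. real n * p n) \<longlonglongrightarrow> - h / \<kappa>"
    using boundary_mass_tendsto[of h 0] assms
    by (simp add: p_def boundary_scale_def divide_inverse)
  have "(\<lambda>n. (real n * p n + real n * H n) / 2) \<longlonglongrightarrow> (- h / \<kappa> + 0) / 2"
    unfolding H_def by (intro tendsto_intros p hellinger_rate assms) simp
  then have pH: "(\<lambda>n. real n * ((p n + H n) / 2)) \<longlonglongrightarrow> - h / \<kappa> / 2"
    by (simp add: distrib_left)
  have "D \<longlonglongrightarrow> exp (- (- h / \<kappa>)) + c - 2 * sqrt c * exp (- (- h / \<kappa> / 2))"
    unfolding D_def by (intro tendsto_intros one_minus_power_tendsto_exp p pH)
  also have "exp (- (- h / \<kappa>)) = c"
    by (simp add: c_def)
  also have "exp (- (- h / \<kappa> / 2)) = sqrt c"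
    unfolding sqrt_c by simp
  also have "c + c - 2 * sqrt c * sqrt c = 0"
    using \<open>0 < c\<close> by simp
  finally have D: "D \<longlonglongrightarrow> 0" .
  \<comment> \<open>\<open>k\<close> balances the errors \<open>k c\<close> and \<open>D / k\<close>; the summand \<open>1 / Suc n\<close> keeps it positive where
      \<open>D\<close> vanishes.\<close>
  define k where "k n = sqrt \<bar>D n\<bar> + 1 / real (Suc n)" for n
  define r where "r n = k n * c + sqrt \<bar>D n\<bar>" for n
  have sD: "(\<lambda>n. sqrt \<bar>D n\<bar>) \<longlonglongrightarrow> 0"
    using tendsto_real_sqrt[OF tendsto_rabs_zero[OF D]] by simp
  have k_pos: "0 < k n" for n
    by (simp add: k_def add_nonneg_pos)
  have "(\<lambda>n. 1 / real (Suc n)) \<longlonglongrightarrow> 0"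
    using lim_inverse_n' LIMSEQ_Suc by blast
  then have "r \<longlonglongrightarrow> (0 + 0) * c + 0"
    unfolding r_def k_def by (intro tendsto_intros sD)
  then have r: "r \<longlonglongrightarrow> 0" by simp
  have Dk: "D n / k n \<le> sqrt \<bar>D n\<bar>" for n
  proof -
    have "D n \<le> sqrt \<bar>D n\<bar> * sqrt \<bar>D n\<bar>" by simp
    also have "\<dots> \<le> sqrt \<bar>D n\<bar> * k n" by (intro mult_left_mono) (auto simp: k_def)
    finally show ?thesis using k_pos by (simp add: divide_le_eq)
  qed
  have "\<forall>\<^sub>F n in sequentially. \<forall>\<psi>. is_test n \<psi> \<longrightarrow>
      (\<integral>y. \<psi> y \<partial>sample_law \<Y> f g n (\<theta>\<^sub>0 + h / real n))
        \<le> 1 - c + c * (\<integral>y. \<psi> y \<partial>sample_law \<Y> f g n \<theta>\<^sub>0) + r n"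
    using eventually_local_parameter_in_T[of h]
  proof (eventually_elim, intro allI impI)
    fix n \<psi>
    assume \<theta>: "\<theta>\<^sub>0 + h / real n \<in> T" and \<psi>: "is_test n \<psi>"
    \<comment> \<open>Acceptance is compared, not rejection: the rejection probability of the alternative also
        has a contribution from below \<open>g \<theta>\<^sub>0\<close>, on which the null gives no control.\<close>
    define w where "w y = 1 - \<psi> y" for y
    have m: "\<psi> \<in> borel_measurable (PiM {1..n} (\<lambda>_. borel))"
      "w \<in> borel_measurable (PiM {1..n} (\<lambda>_. borel))"
      using \<psi> unfolding is_test_def w_def by auto
    have w_exp: "(\<integral>y. w y \<partial>sample_law \<Y> f g n \<theta>) = 1 - (\<integral>y. \<psi> y \<partial>sample_law \<Y> f g n \<theta>)"
      if "\<theta> \<in> T" for \<theta>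
    proof -
      interpret prob_space "sample_law \<Y> f g n \<theta>" using prob_space_sample_law that .
      have "space (sample_law \<Y> f g n \<theta>) = space (PiM {1..n} (\<lambda>_. borel))"
        by (rule sets_eq_imp_space_eq[OF sets_sample_law])
      then have "integrable (sample_law \<Y> f g n \<theta>) \<psi>"
        using \<psi> m(1) by (intro integrable_const_bound[of _ 1] AE_I2)
          (auto simp: is_test_def cong: measurable_cong_sets sets_sample_law)
      then show ?thesis unfolding w_def by (simp add: prob_space)
    qed
    have "c * (\<integral>y. w y \<partial>sample_law \<Y> f g n \<theta>\<^sub>0)
      \<le> (\<integral>y. w y \<partial>sample_law \<Y> f g n (\<theta>\<^sub>0 + h / real n)) + k n * c + D n / k n"
      unfolding D_def p_def H_def integral_dens_above[OF \<theta>, symmetric] hellinger_above(2)[OF \<theta>, symmetric]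
      using \<psi> \<open>0 < c\<close> k_pos by (intro acceptance_comparison \<theta> m) (auto simp: is_test_def w_def)
    with Dk[of n] show "(\<integral>y. \<psi> y \<partial>sample_law \<Y> f g n (\<theta>\<^sub>0 + h / real n))
        \<le> 1 - c + c * (\<integral>y. \<psi> y \<partial>sample_law \<Y> f g n \<theta>\<^sub>0) + r n"
      by (simp add: w_exp \<theta> \<theta>\<^sub>0_in_T r_def algebra_simps)
  qed
  with r show thesis unfolding c_def by (rule that)
qed

lemma phi_plus_rejection_tendsto:
  assumes "0 < \<alpha>" "\<alpha> < 1" "h \<le> \<kappa> * ln (1 / (1 - \<alpha>))"
  shows "(\<lambda>n. \<integral>y. phi_plus \<theta>\<^sub>0 f g dg \<alpha> n y \<partial>sample_law \<Y> f g n (\<theta>\<^sub>0 + h / real n))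
    \<longlonglongrightarrow> 1 - (1 - \<alpha>) * exp (h / \<kappa>)"
proof -
  have "exp (- (\<kappa> * ln (1 / (1 - \<alpha>)) - h) / \<kappa>) = exp (ln (1 - \<alpha>) + h / \<kappa>)"
    using assms scale_pos by (simp add: ln_div field_simps)
  also have "\<dots> = (1 - \<alpha>) * exp (h / \<kappa>)"
    using assms by (simp add: exp_add)
  finally have limit: "exp (- (\<kappa> * ln (1 / (1 - \<alpha>)) - h) / \<kappa>) = (1 - \<alpha>) * exp (h / \<kappa>)" .
  show ?thesis
    using min_test_rejection_tendsto[OF assms(3)] unfolding limit
    by (rule Lim_transform_eventually)
       (use phi_plus_eventually[OF assms(1,2)] in \<open>auto elim!: eventually_mono\<close>)
qed

text \<open>
  The limiting rejection probability decreases in \<open>h\<close> and equals \<open>\<alpha>\<close> at \<open>h = 0\<close>. Beyond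
  \<open>h = \<kappa> ln (1 / (1 - \<alpha>))\<close> the support starts above the critical value and the test never rejects.
\<close>

lemma phi_plus_level:
  assumes "0 < \<alpha>" "\<alpha> < 1" "0 \<le> h"
  shows "limsup (\<lambda>n. ereal (\<integral>y. phi_plus \<theta>\<^sub>0 f g dg \<alpha> n y
    \<partial>sample_law \<Y> f g n (\<theta>\<^sub>0 + h / real n))) \<le> ereal \<alpha>"
proof (cases "h \<le> \<kappa> * ln (1 / (1 - \<alpha>))")
  case True
  have "(1 - \<alpha>) * 1 \<le> (1 - \<alpha>) * exp (h / \<kappa>)"
    using assms scale_pos by (intro mult_left_mono) auto
  then have "1 - (1 - \<alpha>) * exp (h / \<kappa>) \<le> \<alpha>"
    unfolding mult_1_right by linarith
  moreover have "limsup (\<lambda>n. ereal (\<integral>y. phi_plus \<theta>\<^sub>0 f g dg \<alpha> n y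
      \<partial>sample_law \<Y> f g n (\<theta>\<^sub>0 + h / real n))) = ereal (1 - (1 - \<alpha>) * exp (h / \<kappa>))"
    by (intro lim_imp_Limsup tendsto_ereal phi_plus_rejection_tendsto assms True) simp
  ultimately show ?thesis by simp
next
  case False
  have "\<forall>\<^sub>F n in sequentially.
      (\<integral>y. phi_plus \<theta>\<^sub>0 f g dg \<alpha> n y \<partial>sample_law \<Y> f g n (\<theta>\<^sub>0 + h / real n)) = 0"
    using phi_plus_eventually[OF assms(1,2)]
      min_test_never_rejects[OF less_imp_le, OF False[unfolded not_le]]
    by eventually_elim simp
  then show ?thesis
    using assms by (intro Limsup_bounded) (auto elim!: eventually_mono)
qed

lemma asymptotic_power_bound:
  assumes "h < 0" and \<psi>: "\<And>n. is_test n (\<psi> n)"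
    and level: "limsup (\<lambda>n. ereal (\<integral>y. \<psi> n y \<partial>sample_law \<Y> f g n \<theta>\<^sub>0)) \<le> ereal \<alpha>"
  shows "limsup (\<lambda>n. ereal (\<integral>y. \<psi> n y \<partial>sample_law \<Y> f g n (\<theta>\<^sub>0 + h / real n)))
    \<le> ereal (1 - (1 - \<alpha>) * exp (h / \<kappa>))"
proof (rule ereal_le_epsilon2)
  fix e :: real assume "0 < e"
  define c where "c = exp (h / \<kappa>)"
  have c: "0 < c" "c < 1"
    using \<open>h < 0\<close> scale_pos by (auto simp: c_def divide_neg_pos)
  obtain r where r: "r \<longlonglongrightarrow> 0"
    "\<forall>\<^sub>F n in sequentially. \<forall>\<psi>. is_test n \<psi> \<longrightarrow>
      (\<integral>y. \<psi> y \<partial>sample_law \<Y> f g n (\<theta>\<^sub>0 + h / real n))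
        \<le> 1 - exp (h / \<kappa>) + exp (h / \<kappa>) * (\<integral>y. \<psi> y \<partial>sample_law \<Y> f g n \<theta>\<^sub>0) + r n"
    by (rule power_envelope[OF \<open>h < 0\<close>], rule that)
  have "limsup (\<lambda>n. ereal (\<integral>y. \<psi> n y \<partial>sample_law \<Y> f g n \<theta>\<^sub>0)) < ereal (\<alpha> + e / 2)"
    using level \<open>0 < e\<close> by (simp add: le_less_trans)
  then have "\<forall>\<^sub>F n in sequentially. (\<integral>y. \<psi> n y \<partial>sample_law \<Y> f g n \<theta>\<^sub>0) < \<alpha> + e / 2"
    by (auto dest: Limsup_lessD)
  moreover have "\<forall>\<^sub>F n in sequentially. r n < e / 2"
    using order_tendstoD(2)[OF r(1), of "e / 2"] \<open>0 < e\<close> by simp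
  ultimately have "\<forall>\<^sub>F n in sequentially.
      (\<integral>y. \<psi> n y \<partial>sample_law \<Y> f g n (\<theta>\<^sub>0 + h / real n)) \<le> 1 - (1 - \<alpha>) * c + e"
    using r(2)
  proof eventually_elim
    case (elim n)
    have "(\<integral>y. \<psi> n y \<partial>sample_law \<Y> f g n (\<theta>\<^sub>0 + h / real n))
        \<le> 1 - c + c * (\<integral>y. \<psi> n y \<partial>sample_law \<Y> f g n \<theta>\<^sub>0) + r n"
      using elim(3) \<psi>[of n] unfolding c_def by blast
    also have "\<dots> \<le> 1 - c + c * (\<alpha> + e / 2) + e / 2"
      using elim c by (intro add_mono mult_left_mono) auto
    also have "\<dots> \<le> 1 - c + (c * \<alpha> + e / 2) + e / 2"
      using mult_right_mono[of c 1 "e / 2"] c \<open>0 < e\<close> unfolding distrib_left by linarith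
    also have "\<dots> = 1 - (1 - \<alpha>) * c + e"
      by (simp add: algebra_simps)
    finally show ?case .
  qed
  then show "limsup (\<lambda>n. ereal (\<integral>y. \<psi> n y \<partial>sample_law \<Y> f g n (\<theta>\<^sub>0 + h / real n)))
    \<le> ereal (1 - (1 - \<alpha>) * exp (h / \<kappa>)) + ereal e"
    by (intro Limsup_bounded) (auto simp: c_def elim!: eventually_mono)
qed

end

theorem theorem2:
  fixes T \<H> \<Y> :: "real set" and \<theta>\<^sub>0 \<alpha> :: real
    and f df ddf :: "real \<Rightarrow> real \<Rightarrow> real" and g dg :: "real \<Rightarrow> real"
  assumes "0 < \<alpha>" and "\<alpha> < 1"
    and "parameter_dependent_support T \<theta>\<^sub>0 \<H> \<Y> f df ddf g dg"
  shows "AUMP (\<lambda>n h. sample_law \<Y> f g n (\<theta>\<^sub>0 + h / real n))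
           {h \<in> \<H>. 0 \<le> h} {h \<in> \<H>. h < 0} \<alpha> (phi_plus \<theta>\<^sub>0 f g dg \<alpha>)"
proof -
  interpret parameter_dependent_support T \<theta>\<^sub>0 \<H> \<Y> f df ddf g dg by fact
  show ?thesis
    unfolding AUMP_def
  proof (intro conjI allI impI ballI)
    show "is_test n (phi_plus \<theta>\<^sub>0 f g dg \<alpha> n)" for n
      by (rule is_test_phi_plus)
    show "asymptotic_level (\<lambda>n h. sample_law \<Y> f g n (\<theta>\<^sub>0 + h / real n)) {h \<in> \<H>. 0 \<le> h} \<alpha>
        (phi_plus \<theta>\<^sub>0 f g dg \<alpha>)"
      unfolding asymptotic_level_def using phi_plus_level[OF assms(1,2)] by blast
  next
    fix \<psi> h
    assume \<psi>: "\<forall>n. is_test n (\<psi> n)" and h: "h \<in> {h \<in> \<H>. h < 0}"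
      and level: "asymptotic_level (\<lambda>n h. sample_law \<Y> f g n (\<theta>\<^sub>0 + h / real n)) {h \<in> \<H>. 0 \<le> h} \<alpha> \<psi>"
    have "limsup (\<lambda>n. ereal (\<integral>y. \<psi> n y \<partial>sample_law \<Y> f g n (\<theta>\<^sub>0 + 0 / real n))) \<le> ereal \<alpha>"
      using level zero_in_H unfolding asymptotic_level_def by blast
    then have "limsup (\<lambda>n. ereal (\<integral>y. \<psi> n y \<partial>sample_law \<Y> f g n (\<theta>\<^sub>0 + h / real n)))
        \<le> ereal (1 - (1 - \<alpha>) * exp (h / \<kappa>))"
      using h \<psi> by (intro asymptotic_power_bound) auto
    also have "ereal (1 - (1 - \<alpha>) * exp (h / \<kappa>))
        = liminf (\<lambda>n. ereal (\<integral>y. phi_plus \<theta>\<^sub>0 f g dg \<alpha> n y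
            \<partial>sample_law \<Y> f g n (\<theta>\<^sub>0 + h / real n)))"
    proof (intro lim_imp_Liminf[symmetric] tendsto_ereal phi_plus_rejection_tendsto assms)
      have "0 \<le> \<kappa> * ln (1 / (1 - \<alpha>))"
        using assms scale_pos by simp
      then show "h \<le> \<kappa> * ln (1 / (1 - \<alpha>))"
        using h by simp
    qed simp
    finally show "limsup (\<lambda>n. ereal (\<integral>y. \<psi> n y \<partial>sample_law \<Y> f g n (\<theta>\<^sub>0 + h / real n)))
        \<le> liminf (\<lambda>n. ereal (\<integral>y. phi_plus \<theta>\<^sub>0 f g dg \<alpha> n y
            \<partial>sample_law \<Y> f g n (\<theta>\<^sub>0 + h / real n)))" .
  qed
qed

end
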